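(* Let $G$ be a graph of type $3_n$, with parameters $s_1\le s_2\le s_3$, $m_1,m_2,m_3$ and zigzags $Z_{i,k}$ ($1\le i\le 3$, $1\le k\le m_i$) as defined in the context. Then: (i) The $z$-vector of $G$ is $(4s_1)^{m_1},(4s_2)^{m_2},(4s_3)^{m_3}$ (that is, all zigzags of $G$ are simple, and for each $i\in\{1,2,3\}$ there are $m_i$ zigzags $Z_{i,1},\dots,Z_{i,m_i}$ of length $4s_i$, these $m_1+m_2+m_3$ zigzags being all zigzags of $G$); the number of railroads of $G$ is $m_1+m_2+m_3-3$. (ii) $G$ has at least three zigzags, with equality if and only if $G$ is tight. (iii) If $G$ is tight, then its $z$-vector is $n^3$, i.e. $G$ has exactly three zigzags, each simple and of length $n$ (so each zigzag is a Hamiltonian circuit). (iv) $G$ is $z$-balanced, and for distinct zigzags $Z_{i,k}\ne Z_{j,l}$ the number of common edges is $$|Z_{i,k}\cap Z_{j,l}|=\begin{cases}0 & \text{if } i=j,\\ \dfrac{n}{2m_im_j} & \text{if } i\ne j.\end{cases}$$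
   Context: Plane graphs are finite, simple and connected. A graph of type $3_n$ is (the skeleton of) a simple convex polyhedron with $n$ vertices, i.e. a $3$-connected $3$-valent plane graph, all of whose faces are triangles or hexagons; it has exactly four triangles (the Tetrahedron, $n=4$, is allowed). A zigzag is a circuit of edges obtained by alternately taking the left and the right neighbouring edge at successive vertices (so any two, but no three, consecutive edges lie on a common face); zigzags are considered up to direction and starting point. Each edge is covered exactly twice by zigzags. A zigzag is simple if it has no self-intersection, i.e. it does not traverse any edge twice. Once a zigzag is oriented, an edge that it traverses twice is of type I (resp. type II) if it is traversed in opposite directions (resp. the same direction); the signature of the zigzag is the pair (number of type I self-intersection edges, number of type II self-intersection edges), and it does not depend on the orientation. The $z$-vector lists the lengths of all zigzags with multiplicity as exponent (and with signature as subscript for non-simple zigzags). The intersection vector of a zigzag is the multiset of numbers of edges it has in common with each of the other zigzags. A graph is $z$-balanced if all its zigzags of the same length and the same signature have identical intersection vectors. A railroad is a circuit of hexagonal faces such that each hexagon is adjacent to its two neighbours in the circuit on opposite edges; it is bounded by two "parallel" zigzags. A graph is tight if it has no railroad. A pseudo-road is a sequence of hexagons $a_1,\dots,a_l$ ($l\ge 0$) together with non-hexagonal faces $a_0,a_{l+1}$ such that consecutive faces are adjacent and each $a_i$, $1\le i\le l$, is adjacent to $a_{i-1}$ and $a_{i+1}$ on opposite edges. Parameters of a graph $G$ of type $3_n$: fix a triangle $T_1$ with edges $e_1,e_2,e_3$. For each $i$, let $PR_i$ be the pseudo-road starting at $T_1$ through $e_i$; it ends at another triangle. The union of $T_1$,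 $PR_i$ and that other triangle is a patch bounded by a zigzag $Z_{i,1}$; its length is denoted $4s_i$, and $PR_i$ has $s_i-1$ hexagons. Around this patch there is a maximal sequence of $m_i-1\ge 0$ concentric simple railroads, giving concentric zigzags $Z_{i,1},Z_{i,2},\dots,Z_{i,m_i}$ with $Z_{i,k},Z_{i,k+1}$ bounding the $k$-th railroad; on the other side of $Z_{i,m_i}$ is a patch consisting of the two remaining triangles and a pseudo-road with $s_i-1$ hexagons joining them. The edges $e_i$ are labelled so that $s_1\le s_2\le s_3$. *)

theory Defs
  imports
    "Graph_Theory.Graph_Theory"
    "HOL-Combinatorics.Orbits"
    "HOL-Library.Multiset"
begin

section \<open>Plane graphs as rotation systems\<close>

text \<open>
  A graph embedded in the sphere is given by its symmetric, loop-free digraph of ordered pairs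
  together with, for every vertex, the clockwise cyclic order of the arcs leaving it: \<open>rot M a\<close>
  is the arc following \<open>a\<close> clockwise around its tail.  An arc \<open>(u, v)\<close> is an edge with a direction
  of traversal; the two arcs of an edge are exchanged by \<open>prod.swap\<close>.
\<close>

record 'v plane_map =
  skeleton :: "'v pair_pre_digraph"
  rot :: "'v \<times> 'v \<Rightarrow> 'v \<times> 'v"

abbreviation vertices :: "'v plane_map \<Rightarrow> 'v set" where
  "vertices M \<equiv> pverts (skeleton M)"

abbreviation darts :: "'v plane_map \<Rightarrow> ('v \<times> 'v) set" where
  "darts M \<equiv> parcs (skeleton M)"

definition edge_of :: "'v \<times> 'v \<Rightarrow> 'v set" where
  "edge_of a = {fst a, snd a}"

definition edges :: "'v plane_map \<Rightarrow> 'v set set" where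
  "edges M = edge_of ` darts M"

text \<open>
  Arriving at the head of \<open>a\<close>, the leftmost continuation is the clockwise successor of the arc
  leading back, the rightmost one its predecessor.
\<close>

definition left :: "'v plane_map \<Rightarrow> 'v \<times> 'v \<Rightarrow> 'v \<times> 'v" where
  "left M a = rot M (prod.swap a)"

definition right :: "'v plane_map \<Rightarrow> 'v \<times> 'v \<Rightarrow> 'v \<times> 'v" where
  "right M a = inv (rot M) (prod.swap a)"

text \<open>
  A face is represented by the arcs on its boundary that have the face on their left-hand side;
  its number of sides is thus its cardinality.
\<close>

definition face :: "'v plane_map \<Rightarrow> 'v \<times> 'v \<Rightarrow> ('v \<times> 'v) set" where
  "face M a = orbit (left M) a"

definition faces :: "'v plane_map \<Rightarrow> ('v \<times> 'v) set set" where
  "faces M = face M ` darts M"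

definition triangles :: "'v plane_map \<Rightarrow> ('v \<times> 'v) set set" where
  "triangles M = {F \<in> faces M. card F = 3}"

definition hexagons :: "'v plane_map \<Rightarrow> ('v \<times> 'v) set set" where
  "hexagons M = {F \<in> faces M. card F = 6}"

text \<open>
  The last conjunct is Euler's formula: the closed surface obtained from the connected graph by
  gluing in the faces is the sphere.
\<close>

definition plane_graph :: "'v plane_map \<Rightarrow> bool" where
  "plane_graph M \<longleftrightarrow>
     pair_graph (skeleton M) \<and> connected (with_proj (skeleton M)) \<and>
     rot M permutes darts M \<and>
     (\<forall>v\<in>vertices M. cyclic_on (rot M) (out_arcs (with_proj (skeleton M)) v)) \<and>
     card (vertices M) + card (faces M) = card (edges M) + 2"

definition three_connected :: "'v pair_pre_digraph \<Rightarrow> bool" where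
  "three_connected G \<longleftrightarrow> card (pverts G) > 3 \<and>
     (\<forall>S\<subseteq>pverts G. card S < 3 \<longrightarrow> connected (with_proj G \<restriction> (pverts G - S)))"

definition type_3 :: "nat \<Rightarrow> 'v plane_map \<Rightarrow> bool" where
  "type_3 n M \<longleftrightarrow>
     plane_graph M \<and> card (vertices M) = n \<and>
     (\<forall>v\<in>vertices M. out_degree (with_proj (skeleton M)) v = 3) \<and>
     three_connected (skeleton M) \<and>
     faces M = triangles M \<union> hexagons M"


section \<open>Zigzags\<close>

text \<open>
  The state \<open>(a, b)\<close> of a zigzag walk records the arc \<open>a\<close> being traversed and whether the next
  turn is to the left.  Walking an oriented zigzag backwards, the turn after the reversal of \<open>a\<close>
  is the mirror image of the turn that preceded \<open>a\<close>, so the flag \<open>b\<close> does not change.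
\<close>

definition zz_step :: "'v plane_map \<Rightarrow> ('v \<times> 'v) \<times> bool \<Rightarrow> ('v \<times> 'v) \<times> bool" where
  "zz_step M = (\<lambda>(a, b). (if b then left M a else right M a, \<not> b))"

definition zz_reverse :: "(('v \<times> 'v) \<times> bool) set \<Rightarrow> (('v \<times> 'v) \<times> bool) set" where
  "zz_reverse W = (\<lambda>(a, b). (prod.swap a, b)) ` W"

definition oriented_zigzags :: "'v plane_map \<Rightarrow> (('v \<times> 'v) \<times> bool) set set" where
  "oriented_zigzags M = orbit (zz_step M) ` (darts M \<times> UNIV)"

text \<open>A zigzag up to direction is the set of its two orientations.\<close>

type_synonym 'v zigzag = "(('v \<times> 'v) \<times> bool) set set"

definition zigzags :: "'v plane_map \<Rightarrow> 'v zigzag set" where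
  "zigzags M = (\<lambda>W. {W, zz_reverse W}) ` oriented_zigzags M"

definition zz_length :: "'v zigzag \<Rightarrow> nat" where
  "zz_length z = the_elem (card ` z)"

definition zz_edges :: "'v zigzag \<Rightarrow> 'v set set" where
  "zz_edges z = (\<Union>W\<in>z. (edge_of \<circ> fst) ` W)"

definition simple_zigzag :: "'v zigzag \<Rightarrow> bool" where
  "simple_zigzag z \<longleftrightarrow> (\<forall>W\<in>z. inj_on (edge_of \<circ> fst) W)"

definition type_I_edges :: "(('v \<times> 'v) \<times> bool) set \<Rightarrow> 'v set set" where
  "type_I_edges W = {edge_of a | a b b'. (a, b) \<in> W \<and> (prod.swap a, b') \<in> W}"

definition type_II_edges :: "(('v \<times> 'v) \<times> bool) set \<Rightarrow> 'v set set" where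
  "type_II_edges W = {edge_of a | a. (a, True) \<in> W \<and> (a, False) \<in> W}"

definition signature :: "'v zigzag \<Rightarrow> nat \<times> nat" where
  "signature z = the_elem ((\<lambda>W. (card (type_I_edges W), card (type_II_edges W))) ` z)"

text \<open>Simple zigzags, whose signature is not displayed in the usual notation, get \<open>(0, 0)\<close>.\<close>

definition z_vector :: "'v plane_map \<Rightarrow> (nat \<times> (nat \<times> nat)) multiset" where
  "z_vector M = image_mset (\<lambda>z. (zz_length z, signature z)) (mset_set (zigzags M))"

definition intersection_vector :: "'v plane_map \<Rightarrow> 'v zigzag \<Rightarrow> nat multiset" where
  "intersection_vector M z =
     image_mset (\<lambda>z'. card (zz_edges z \<inter> zz_edges z')) (mset_set (zigzags M - {z}))"

definition z_balanced :: "'v plane_map \<Rightarrow> bool" where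
  "z_balanced M \<longleftrightarrow>
     (\<forall>z\<in>zigzags M. \<forall>z'\<in>zigzags M.
        zz_length z = zz_length z' \<and> signature z = signature z' \<longrightarrow>
        intersection_vector M z = intersection_vector M z')"

definition hamiltonian_zigzag :: "'v plane_map \<Rightarrow> 'v zigzag \<Rightarrow> bool" where
  "hamiltonian_zigzag M z \<longleftrightarrow> (\<forall>W\<in>z. bij_betw (fst \<circ> fst) W (vertices M))"


section \<open>Railroads\<close>

text \<open>
  If \<open>a\<close> has a hexagon on its left, \<open>(left M ^^ 3) a\<close> lies on the opposite edge of that hexagon and
  \<open>straight M a\<close> is the arc of this opposite edge that has the adjacent face on its left.
  A sequence of faces in which one goes straight on through hexagons is represented by the
  arcs \<open>a\<close> through which its faces \<open>face M a\<close> are entered.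
\<close>

definition straight :: "'v plane_map \<Rightarrow> 'v \<times> 'v \<Rightarrow> 'v \<times> 'v" where
  "straight M a = prod.swap ((left M ^^ 3) a)"

definition oriented_railroads :: "'v plane_map \<Rightarrow> ('v \<times> 'v) set set" where
  "oriented_railroads M =
     {R. \<exists>a\<in>darts M. R = orbit (straight M) a \<and> (\<forall>b\<in>R. face M b \<in> hexagons M)}"

text \<open>
  In the opposite direction, every hexagon is entered through the edge by which it was left.
  As for zigzags, a railroad is the set of its two orientations.
\<close>

type_synonym 'v railroad = "('v \<times> 'v) set set"

definition railroads :: "'v plane_map \<Rightarrow> 'v railroad set" where
  "railroads M = (\<lambda>R. {R, (left M ^^ 3) ` R}) ` oriented_railroads M"

definition tight :: "'v plane_map \<Rightarrow> bool" where
  "tight M \<longleftrightarrow> railroads M = {}"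

definition railroad_faces :: "'v plane_map \<Rightarrow> 'v railroad \<Rightarrow> ('v \<times> 'v) set set" where
  "railroad_faces M r = face M ` \<Union>r"

definition simple_railroad :: "'v plane_map \<Rightarrow> 'v railroad \<Rightarrow> bool" where
  "simple_railroad M r \<longleftrightarrow> (\<forall>R\<in>r. inj_on (face M) R)"

text \<open>
  A hexagon of the railroad entered through \<open>a\<close> has, on one side of the railroad, the two
  consecutive edges \<open>left M a\<close> and \<open>left M (left M a)\<close>.  The zigzag bounding the railroad on that
  side traverses them one after the other; the two sides correspond to the two orientations.
\<close>

definition bounding_zigzags :: "'v plane_map \<Rightarrow> 'v railroad \<Rightarrow> 'v zigzag set" where
  "bounding_zigzags M r = {z \<in> zigzags M. \<exists>R\<in>r. \<forall>a\<in>R. (left M a, True) \<in> \<Union>z}"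


section \<open>Pseudo-roads and the parameters of a graph of type 3\<close>

text \<open>
  The pseudo-road \<open>a\<^sub>0, \<dots>, a\<^sub>l\<^sub>+\<^sub>1\<close> is represented by the list of the \<open>l + 1\<close> arcs through which
  \<open>a\<^sub>1, \<dots>, a\<^sub>l\<^sub>+\<^sub>1\<close> are entered; the length of the list is one more than the number of hexagons.
\<close>

definition pseudo_road :: "'v plane_map \<Rightarrow> ('v \<times> 'v) list \<Rightarrow> bool" where
  "pseudo_road M xs \<longleftrightarrow>
     xs \<noteq> [] \<and> set xs \<subseteq> darts M \<and>
     face M (prod.swap (hd xs)) \<notin> hexagons M \<and>
     (\<forall>x\<in>set (butlast xs). face M x \<in> hexagons M) \<and>
     face M (last xs) \<notin> hexagons M \<and>
     (\<forall>j. Suc j < length xs \<longrightarrow> xs ! Suc j = straight M (xs ! j))"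

definition boundary_edges :: "'v plane_map \<Rightarrow> ('v \<times> 'v) set set \<Rightarrow> 'v set set" where
  "boundary_edges M P =
     edge_of ` {a \<in> darts M. face M a \<in> P \<and> face M (prod.swap a) \<notin> P}"

text \<open>
  \<open>concentric_zigzags M P m Z\<close>: the patch \<open>P\<close> (a set of faces) is bounded by \<open>Z 1\<close>, and
  \<open>Z 1, \<dots>, Z m\<close> arise from a maximal sequence of \<open>m - 1\<close> concentric simple railroads
  \<open>R 1, \<dots>, R (m - 1)\<close> around \<open>P\<close>.
\<close>

definition concentric_zigzags ::
    "'v plane_map \<Rightarrow> ('v \<times> 'v) set set \<Rightarrow> nat \<Rightarrow> (nat \<Rightarrow> 'v zigzag) \<Rightarrow> bool" where
  "concentric_zigzags M P m Z \<longleftrightarrow>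
     1 \<le> m \<and> Z 1 \<in> zigzags M \<and> zz_edges (Z 1) = boundary_edges M P \<and>
     (\<exists>R :: nat \<Rightarrow> 'v railroad.
        (\<forall>k\<in>{1..<m}.
           R k \<in> railroads M \<and> simple_railroad M (R k) \<and>
           railroad_faces M (R k) \<inter> (P \<union> (\<Union>j\<in>{1..<k}. railroad_faces M (R j))) = {} \<and>
           bounding_zigzags M (R k) = {Z k, Z (Suc k)}) \<and>
        \<not> (\<exists>r\<in>railroads M. \<exists>z.
           simple_railroad M r \<and>
           railroad_faces M r \<inter> (P \<union> (\<Union>j\<in>{1..<m}. railroad_faces M (R j))) = {} \<and>
           bounding_zigzags M r = {Z m, z}))"

text \<open>
  Here \<open>e 1\<close>, \<open>e 2\<close>, \<open>e 3\<close> are the edges of the triangle \<open>T\<close>, each given as the arc with \<open>T\<close> on its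
  left; so \<open>prod.swap (e i)\<close> enters the face on the other side.  \<open>Z i k\<close> is meaningful for
  \<open>1 \<le> i \<le> 3\<close> and \<open>1 \<le> k \<le> m i\<close> only.
\<close>

definition parameters ::
    "'v plane_map \<Rightarrow> ('v \<times> 'v) set \<Rightarrow> (nat \<Rightarrow> 'v \<times> 'v) \<Rightarrow> (nat \<Rightarrow> nat) \<Rightarrow> (nat \<Rightarrow> nat)
      \<Rightarrow> (nat \<Rightarrow> nat \<Rightarrow> 'v zigzag) \<Rightarrow> bool" where
  "parameters M T e s m Z \<longleftrightarrow>
     T \<in> triangles M \<and> bij_betw e {1..3} T \<and>
     (\<forall>i\<in>{1..3}. \<exists>PR.
        pseudo_road M PR \<and> hd PR = prod.swap (e i) \<and> s i = length PR \<and>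
        concentric_zigzags M (insert T (face M ` set PR)) (m i) (Z i)) \<and>
     s 1 \<le> s 2 \<and> s 2 \<le> s 3"

end

theory Submission
  imports Defs
begin

text \<open>
  Every face size divides 6, so the darts of \<open>M\<close> carry an action of the rotation group of the
  hexagonal lattice.  Its translations are generated by two commuting permutations, going straight
  on through a hexagon (\<open>S\<close>) and its conjugate \<open>U\<close> under \<open>left M\<close>, and \<open>left M\<close> cubed inverts both.
  Relative to a dart \<open>t\<close> of a triangle (one exists by Euler's formula), every dart is therefore of
  the form \<open>E t' k l = S^k U^l t'\<close> for one of the three darts \<open>t'\<close> of the triangle, with
  \<open>left M (E t k l) = E (left M t) (k + l) (- k)\<close>, and \<open>(k, l)\<close> is unique modulo a lattice in
  \<open>2\<int> \<times> 2\<int>\<close>.  Modulo this lattice, \<open>S\<close> has order \<open>2s\<close> and its cosets, the rows, form a cyclic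
  group of order \<open>2m\<close>, so \<open>n = 4sm\<close>.  The rows \<open>l\<close> and \<open>-l\<close> are the two orientations of a road of
  faces, which is a railroad unless \<open>m\<close> divides \<open>l\<close>, and the oriented zigzag along the row \<open>l\<close> is
  the reverse of the one along the row \<open>1 - l\<close>.  All the claims are then congruences modulo \<open>2m\<close>.
\<close>

section \<open>Darts of a cubic map of triangles and hexagons\<close>

text \<open>Behind the coordinates is a folding: \<open>M\<close> is a quotient of the hexagonal
  tiling of the plane by translations and half-turns about centres of hexagons, and a triangle is a
  hexagon folded by its own half-turn. A dart \<open>t\<close> of a triangle serves as origin
  because \<open>left M\<close> cubed fixes it: around \<open>t\<close> this half-turn becomes
  negation of coordinates, and reversal of a dart becomes \<open>(k, l)\<close> to
  \<open>(1 - k, - l)\<close>. These formulas rest on such an origin, hence the search for a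
  triangle. The three darts of the triangle stand for the three directions of translation. Each of
  the three classes of darts has exactly one dart leaving every vertex, whence
  \<open>n = 2s * 2m\<close>; a zigzag uses only the two classes other than that of its row. Zigzags
  from rows of different classes therefore share edges of just one class, and counting these is
  solving one congruence modulo \<open>2 m'\<close> in a row of \<open>2 s\<close> darts, twice
  because of the two orientations: this is the origin of
  \<open>2 s / m' = n / (2 m m')\<close>.\<close>

lemma card_orbit_funpow:
  assumes "x \<in> orbit f x"
  shows "(f ^^ card (orbit f x)) x = x"
proof -
  have "orbit f x = (\<lambda>n. (f ^^ n) x) ` {0..<funpow_dist1 f x x}"
    using orbit_conv_funpow_dist1[OF assms] .
  moreover have "inj_on (\<lambda>n. (f ^^ n) x) {0..<funpow_dist1 f x x}"
    using inj_on_funpow_dist1[OF assms] .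
  ultimately have "card (orbit f x) = funpow_dist1 f x x"
    by (metis card_image card_atLeastLessThan diff_zero)
  then show ?thesis
    using funpow_dist1_prop[OF assms] by metis
qed

text \<open>For counting the darts in three ways: by tail, by edge and by face.\<close>

lemma card_eq_mult_card_image:
  assumes "finite A" "\<And>y. y \<in> f ` A \<Longrightarrow> card {x \<in> A. f x = y} = c"
  shows "card A = c * card (f ` A)"
proof -
  have "card A = (\<Sum>y\<in>f ` A. sum (\<lambda>_. 1) {x \<in> A. f x = y})"
    using sum.image_gen[OF assms(1), of "\<lambda>_. 1 :: nat" f] by simp
  also have "\<dots> = (\<Sum>y\<in>f ` A. c)"
    using assms(2) by (intro sum.cong) auto
  finally show ?thesis by simp
qed

locale type_3_map =
  fixes M :: "'v plane_map" and n :: nat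
  assumes type_3: "type_3 n M"
begin

abbreviation L :: "'v \<times> 'v \<Rightarrow> 'v \<times> 'v" where "L \<equiv> left M"
abbreviation rev_dart :: "'v \<times> 'v \<Rightarrow> 'v \<times> 'v" where "rev_dart \<equiv> prod.swap"
abbreviation D :: "('v \<times> 'v) set" where "D \<equiv> darts M"

sublocale pair_graph "skeleton M"
  using type_3 by (simp add: type_3_def plane_graph_def)

section \<open>Darts around a vertex\<close>

lemma finite_D: "finite D"
  using pair_finite_arcs .

lemma rot_permutes: "rot M permutes D"
  using type_3 by (simp add: type_3_def plane_graph_def)

lemma rev_dart_in_D [simp]: "rev_dart d \<in> D \<longleftrightarrow> d \<in> D"
proof -
  have "sym (parcs (skeleton M))"
    using pair_sym_arcs by (simp add: symmetric_def)
  then show ?thesis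
    by (cases d) (auto dest: symD)
qed

lemma rev_dart_neq: "d \<in> D \<Longrightarrow> rev_dart d \<noteq> d"
  using pair_no_loops[of d] by (cases d) auto

lemma out_arcs_eq: "out_arcs (with_proj (skeleton M)) v = {d \<in> D. fst d = v}"
  by (auto simp: out_arcs_def)

lemma rot_in_D [simp]: "rot M d \<in> D \<longleftrightarrow> d \<in> D"
  using rot_permutes by (rule permutes_in_image)

lemma rot_cyclic:
  assumes "d \<in> D"
  shows "orbit (rot M) d = {d' \<in> D. fst d' = fst d}"
proof -
  have "fst d \<in> vertices M"
    using assms arc_fst_in_verts by blast
  then have "cyclic_on (rot M) {d' \<in> D. fst d' = fst d}"
    using type_3 by (simp add: type_3_def plane_graph_def flip: out_arcs_eq)
  then show ?thesis
    using assms unfolding cyclic_on_alldef by fastforce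
qed

lemma card_out: "v \<in> vertices M \<Longrightarrow> card {d \<in> D. fst d = v} = 3"
  using type_3 by (simp add: type_3_def out_degree_def flip: out_arcs_eq)

lemma card_vertices: "card (vertices M) = n"
  using type_3 by (simp add: type_3_def)

text \<open>Unconditional because \<open>rot M\<close> fixes everything outside \<open>D\<close>.
  The word identities below can then be proved by rewriting without membership conditions.\<close>

lemma rot_rot_rot [simp]: "rot M (rot M (rot M d)) = d"
proof (cases "d \<in> D")
  case True
  then have "card (orbit (rot M) d) = 3"
    using card_out[of "fst d"] arc_fst_in_verts by (simp add: rot_cyclic)
  moreover have "d \<in> orbit (rot M) d"
    using True by (simp add: rot_cyclic)
  ultimately show ?thesis
    using card_orbit_funpow[of d "rot M"] by (simp add: eval_nat_numeral)
next
  case False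
  then show ?thesis
    using rot_permutes by (simp add: permutes_not_in)
qed

lemma fst_rot [simp]: "d \<in> D \<Longrightarrow> fst (rot M d) = fst d"
  using rot_cyclic[of d] orbit.base[of "rot M" d] by auto

lemma same_tail:
  assumes "d \<in> D" "d' \<in> D" "fst d' = fst d"
  shows "d' \<in> {d, rot M d, rot M (rot M d)}"
proof -
  have "d' \<in> orbit (rot M) d"
    using assms by (simp add: rot_cyclic)
  then show ?thesis
    by induct auto
qed

section \<open>Darts around a face\<close>

lemma rot_eq: "rot M d = L (rev_dart d)"
  by (simp add: left_def)

lemma L_in_D [simp]: "L d \<in> D \<longleftrightarrow> d \<in> D"
  by (simp add: left_def)

lemma bij_L: "bij L"
proof -
  have "L = rot M \<circ> rev_dart" by (auto simp: left_def)
  then show ?thesis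
    using rot_permutes permutes_bij bij_swap bij_comp by metis
qed

lemma L_eq_iff [simp]: "L d = L d' \<longleftrightarrow> d = d'"
  using bij_L by (simp add: bij_def inj_eq)

lemma self_in_face [simp]:
  assumes "d \<in> D"
  shows "d \<in> face M d"
proof -
  have "(L ^^ k) d \<in> D" for k
    using assms by (induct k) auto
  then have "finite {y. \<exists>k. y = (L ^^ k) d}"
    by (intro finite_subset[OF _ finite_D]) auto
  with bij_L obtain k where "k > 0" "(L ^^ k) d = d"
    by (metis bij_is_inj funpow_inj_finite)
  then show ?thesis
    unfolding face_def orbit_altdef by force
qed

lemma face_subset_D:
  assumes "d \<in> D"
  shows "face M d \<subseteq> D"
proof
  fix d' assume "d' \<in> face M d"
  then show "d' \<in> D"
    unfolding face_def using assms by induct auto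
qed

lemma card_face_cases:
  assumes "d \<in> D"
  shows "card (face M d) = 3 \<or> card (face M d) = 6"
proof -
  have "face M d \<in> triangles M \<union> hexagons M"
    using assms type_3 by (auto simp: type_3_def faces_def)
  then show ?thesis
    by (auto simp: triangles_def hexagons_def)
qed

lemma L_neq [simp]: "d \<in> D \<Longrightarrow> L d \<noteq> d"
  using card_face_cases[of d] by (auto simp: face_def simp flip: orbit_eq_singleton_iff)

lemma L_L_neq:
  assumes "d \<in> D"
  shows "L (L d) \<noteq> d"
proof
  assume "L (L d) = d"
  have "d' \<in> face M d \<Longrightarrow> d' \<in> {d, L d}" for d'
    unfolding face_def by (induct rule: orbit.induct) (auto simp: \<open>L (L d) = d\<close>)
  then have "card (face M d) \<le> card {d, L d}"
    by (intro card_mono) auto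
  also have "\<dots> \<le> 2"
    by (simp add: card_insert_if)
  finally show False
    using card_face_cases[OF assms] by auto
qed

text \<open>Both face sizes divide 6. Outside \<open>D\<close>, \<open>L\<close> is merely
  \<open>prod.swap\<close>, so its sixth power is trivial there as well.\<close>

lemma L6 [simp]: "L (L (L (L (L (L d))))) = d"
proof (cases "d \<in> D")
  case True
  then have "(L ^^ card (face M d)) d = d"
    using card_orbit_funpow[of d L] by (simp add: face_def flip: face_def)
  then show ?thesis
    using card_face_cases[OF True] by (auto simp: eval_nat_numeral)
next
  case False
  then show ?thesis
    using rot_permutes by (simp add: permutes_not_in left_def)
qed

lemma face_eq:
  assumes "d \<in> D"
  shows "face M d = {d, L d, L (L d), L (L (L d)), L (L (L (L d))), L (L (L (L (L d))))}"
proof -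
  have "face M d = {(L ^^ m) d |m. m < 6}"
    unfolding face_def by (rule orbit_altdef_bounded) (simp_all add: eval_nat_numeral)
  also have "\<dots> = (\<lambda>m. (L ^^ m) d) ` {..<6}"
    by auto
  also have "{..<6} = {0, 1, 2, 3, 4, 5 :: nat}"
    by auto
  finally show ?thesis by (simp add: eval_nat_numeral)
qed

lemma card_face_eq_3:
  assumes "d \<in> D"
  shows "card (face M d) = 3 \<longleftrightarrow> L (L (L d)) = d"
proof
  assume "L (L (L d)) = d"
  then have "face M d = {d, L d, L (L d)}"
    using face_eq[OF assms] by auto
  then show "card (face M d) = 3"
    using L_neq[OF assms] L_L_neq[OF assms] by (auto simp: card_insert_if dest: sym)
next
  assume "card (face M d) = 3"
  then show "L (L (L d)) = d"
    using card_orbit_funpow[of d L] self_in_face[OF assms] by (simp add: face_def eval_nat_numeral)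
qed

lemma hexagon_iff: "d \<in> D \<Longrightarrow> face M d \<in> hexagons M \<longleftrightarrow> L (L (L d)) \<noteq> d"
  using card_face_cases[of d] card_face_eq_3[of d] by (auto simp: hexagons_def faces_def)

lemma face_eq_iff:
  assumes "d \<in> D" "d' \<in> D"
  shows "face M d = face M d' \<longleftrightarrow> d' \<in> face M d"
proof
  assume "d' \<in> face M d"
  then show "face M d = face M d'"
    using self_in_face assms unfolding face_def by (metis orbit_cyclic_eq3 cyclic_on_def)
qed (use assms in auto)

text \<open>If all faces were hexagons, counting darts would give 3V = 2E = 6F, hence V - E + F = 0
  against Euler's formula.\<close>

lemma triangles_nonempty: "triangles M \<noteq> {}"
proof
  assume "triangles M = {}"
  then have hex: "card (face M d) = 6" if "d \<in> D" for d
    using that card_face_cases[OF that] by (auto simp: triangles_def faces_def)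
  have "{x \<in> D. face M x = face M d} = face M d" if "d \<in> D" for d
    using that face_eq_iff[of d] face_subset_D[OF that] by auto
  then have "card D = 6 * card (faces M)"
    unfolding faces_def by (intro card_eq_mult_card_image finite_D) (auto simp: hex)
  moreover have "{x \<in> D. edge_of x = edge_of d} = {d, rev_dart d}" if "d \<in> D" for d
    using that rev_dart_in_D[of d] by (cases d) (auto simp: edge_of_def doubleton_eq_iff)
  then have "card D = 2 * card (edges M)"
    unfolding edges_def by (intro card_eq_mult_card_image finite_D) (force dest: rev_dart_neq)
  moreover have "card D = 3 * card (fst ` D)"
    by (intro card_eq_mult_card_image finite_D) (auto, metis card_out in_arcsD1)
  moreover have "fst ` D = vertices M"
  proof
    show "vertices M \<subseteq> fst ` D"
    proof
      fix v assume "v \<in> vertices M"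
      then have "{d \<in> D. fst d = v} \<noteq> {}"
        using card_out[of v] by (metis card.empty zero_neq_numeral)
      then show "v \<in> fst ` D" by force
    qed
  qed (auto dest: in_arcsD1)
  moreover have "card (vertices M) + card (faces M) = card (edges M) + 2"
    using type_3 unfolding type_3_def plane_graph_def by blast
  ultimately show False by simp
qed

text \<open>Transitivity on darts. Since \<open>rot M\<close> is \<open>L\<close> after reversal, a
  set closed under both contains all darts at a vertex once it contains one, and reversal carries it
  to the neighbouring vertices; connectedness does the rest.\<close>

lemma closed_set_eq_D:
  assumes "X \<subseteq> D" "X \<noteq> {}" and L: "\<And>d. d \<in> X \<Longrightarrow> L d \<in> X" and rev: "\<And>d. d \<in> X \<Longrightarrow> rev_dart d \<in> X"
  shows "X = D"
proof -
  have rot: "rot M d \<in> X" if "d \<in> X" for d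
    using L rev that by (metis rot_eq)
  have out: "d' \<in> X" if "d \<in> X" "d' \<in> D" "fst d' = fst d" for d d'
    using same_tail[of d d'] that rot[of d] rot[of "rot M d"] assms(1) by blast
  have next_tail: "v \<in> fst ` X" if "(u, v) \<in> D" "u \<in> fst ` X" for u v
  proof -
    have "(u, v) \<in> X" using that out by force
    then have "(v, u) \<in> X" using rev by force
    then show ?thesis by force
  qed
  \<comment> \<open>The digraph is symmetric, so every vertex is reached along arcs in their own
    direction.\<close>
  have strong: "strongly_connected (with_proj (skeleton M))"
    using type_3 pair_sym_arcs
    by (intro symmetric_connected_imp_strongly_connected) (auto simp: type_3_def plane_graph_def)
  obtain d0 where "d0 \<in> X" using assms(2) by blast
  have "d \<in> X" if "d \<in> D" for d
  proof -
    have "fst d0 \<rightarrow>\<^sup>*\<^bsub>with_proj (skeleton M)\<^esub> fst d"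
      using strong that \<open>d0 \<in> X\<close> assms(1) arc_fst_in_verts unfolding strongly_connected_def by auto
    then have "fst d \<in> fst ` X"
    proof (induct rule: reachable_induct)
      case base
      then show ?case using \<open>d0 \<in> X\<close> by auto
    next
      case (step x y)
      then show ?case using next_tail by auto
    qed
    then obtain d1 where "d1 \<in> X" "fst d = fst d1" by auto
    then show ?thesis using out that by blast
  qed
  then show ?thesis using assms(1) by blast
qed

end


section \<open>Translations\<close>

definition ipow :: "('a \<Rightarrow> 'a) \<Rightarrow> int \<Rightarrow> 'a \<Rightarrow> 'a" where
  "ipow f k = (if 0 \<le> k then f ^^ nat k else inv f ^^ nat (- k))"

lemma ipow_0 [simp]: "ipow f 0 x = x"
  by (simp add: ipow_def)

lemma ipow_Suc:
  assumes "bij f"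
  shows "ipow f (k + 1) x = f (ipow f k x)"
proof (cases "0 \<le> k")
  case True
  then have "nat (k + 1) = Suc (nat k)" by simp
  with True show ?thesis by (simp add: ipow_def)
next
  case False
  then have "nat (- k) = Suc (nat (- (k + 1)))" by simp
  with False show ?thesis
    using assms by (auto simp: ipow_def bij_is_surj surj_f_inv_f)
qed

lemma ipow_pred: "bij f \<Longrightarrow> f (ipow f (k - 1) x) = ipow f k x"
  using ipow_Suc[of f "k - 1"] by simp

text \<open>With \<open>g = L\<close> this carries a conjugation of translations over to all their
  powers; with \<open>f = f'\<close> it gives commutation.\<close>

lemma ipow_semiconj:
  assumes "bij f" "bij f'" "\<And>x. g (f x) = f' (g x)"
  shows "g (ipow f k x) = ipow f' k (g x)"
proof (induct k rule: int_induct[where k = 0])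
  case (step1 i)
  then show ?case using assms by (simp add: ipow_Suc)
next
  case (step2 i)
  have "f' (g (ipow f (i - 1) x)) = f' (ipow f' (i - 1) (g x))"
    using step2 assms by (metis ipow_pred)
  then show ?case
    using assms(2) by (simp add: bij_is_inj inj_eq)
qed simp

lemma ipow_add:
  assumes "bij f"
  shows "ipow f (j + k) x = ipow f j (ipow f k x)"
proof (induct j rule: int_induct[where k = 0])
  case (step1 i)
  then show ?case
    using ipow_Suc[OF assms, of "i + k" x] ipow_Suc[OF assms, of i "ipow f k x"]
    by (simp add: algebra_simps)
next
  case (step2 i)
  have "f (ipow f (i - 1 + k) x) = f (ipow f (i - 1) (ipow f k x))"
    using step2 assms ipow_pred[of f "i + k" x] ipow_pred[of f i "ipow f k x"]
    by (simp add: algebra_simps)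
  then show ?case
    using assms by (simp add: bij_is_inj inj_eq)
qed simp

lemma ipow_commute:
  assumes "bij f" "bij g" "\<And>x. f (g x) = g (f x)"
  shows "ipow f j (ipow g k x) = ipow g k (ipow f j x)"
proof -
  have "ipow g k (f y) = f (ipow g k y)" for y
    using ipow_semiconj[of g g f k y] assms by simp
  then show ?thesis
    using ipow_semiconj[of f f "ipow g k" j x] assms by simp
qed

text \<open>The powers of a product of two commuting maps, in the form needed to split
  \<open>S\<close> into two translations.\<close>

lemma ipow_comp:
  assumes "bij f" "bij g" "bij h" "\<And>x. f (g x) = g (f x)" "\<And>x. h x = f (g x)"
  shows "ipow h k x = ipow f k (ipow g k x)"
proof -
  have g_f: "g (ipow f j y) = ipow f j (g y)" for j y
    using ipow_semiconj[of f f g j y] assms by simp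
  show ?thesis
  proof (induct k rule: int_induct[where k = 0])
    case (step1 i)
    have "ipow f (i + 1) (ipow g (i + 1) x) = f (g (ipow f i (ipow g i x)))"
      using assms(1,2) by (simp only: ipow_Suc g_f)
    moreover have "ipow h (i + 1) x = f (g (ipow h i x))"
      using ipow_Suc[OF assms(3)] assms(5) by metis
    ultimately show ?case by (simp only: step1(2))
  next
    case (step2 i)
    have "h (ipow f (i - 1) (ipow g (i - 1) x)) = ipow f i (ipow g i x)"
      by (simp only: assms(5) g_f ipow_pred[OF assms(1)] ipow_pred[OF assms(2)])
    also have "\<dots> = h (ipow h (i - 1) x)"
      using step2 by (simp only: ipow_pred[OF assms(3)])
    finally show ?case
      using assms(3) by (simp add: bij_is_inj inj_eq)
  qed simp
qed

context type_3_map
begin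

section \<open>Relations between \<open>L\<close>, reversal and the two translations\<close>

abbreviation S :: "'v \<times> 'v \<Rightarrow> 'v \<times> 'v" where "S \<equiv> straight M"

text \<open>Five applications of \<open>L\<close> stand for its inverse, which keeps every identity
  within reach of the simplification rule \<open>L6\<close>.\<close>

definition U :: "'v \<times> 'v \<Rightarrow> 'v \<times> 'v" where
  "U d = L (L (L (L (L (S (L d))))))"

definition E :: "'v \<times> 'v \<Rightarrow> int \<Rightarrow> int \<Rightarrow> 'v \<times> 'v" where
  "E t k l = ipow S k (ipow U l t)"

lemma S_eq: "S d = rev_dart (L (L (L d)))"
  by (simp add: straight_def eval_nat_numeral)

lemma L_U: "L (U d) = S (L d)"
  by (simp add: U_def)

text \<open>The relation "\<open>L\<close> after reversal has order 3" of a 3-valent vertex, solved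
  for the conjugate of \<open>L\<close> by reversal. The next two lemmas are the same relation for
  the powers -1 and -2 of \<open>L\<close>.\<close>

lemma rev_L_rev: "rev_dart (L (rev_dart d)) = L (L (L (L (L (rev_dart (L (L (L (L (L d)))))))))) "
proof -
  have "L (rev_dart (L (rev_dart (L (rev_dart x))))) = x" for x
    using rot_rot_rot[of x] by (simp add: rot_eq)
  from this[of "rev_dart (L (L (L (L (L d)))))"]
  have "L (rev_dart (L (rev_dart d))) = rev_dart (L (L (L (L (L d)))))"
    by simp
  then have "L (L (L (L (L (L (rev_dart (L (rev_dart d)))))))) = L (L (L (L (L (rev_dart (L (L (L (L (L d))))))))))"
    by simp
  then show ?thesis by simp
qed

lemma rev_L5_rev: "rev_dart (L (L (L (L (L (rev_dart d)))))) = L (rev_dart (L d))"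
proof -
  have "rev_dart (rev_dart (L (rev_dart (L d)))) = rev_dart (L (L (L (L (L (rev_dart d))))))"
    using rev_L_rev[of "L d"] by simp
  then show ?thesis by simp
qed

lemma rev_L4_rev: "rev_dart (L (L (L (L (rev_dart d))))) = L (rev_dart (L (L (rev_dart (L d)))))"
proof -
  have "rev_dart (L (L (L (L (rev_dart d))))) =
      rev_dart (L (L (L (L (L (rev_dart (rev_dart (L (L (L (L (L (rev_dart d)))))))))))))"
    by simp
  also have "\<dots> = L (rev_dart (L (L (rev_dart (L d)))))"
    by (simp only: rev_L5_rev)
  finally show ?thesis .
qed

lemma bij_rev: "bij rev_dart"
  by (rule bij_swap)

lemma bij_S: "bij S"
proof -
  have "S = rev_dart \<circ> L \<circ> L \<circ> L" by (simp add: fun_eq_iff S_eq)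
  then show ?thesis using bij_L bij_rev bij_comp by metis
qed

lemma bij_U: "bij U"
proof -
  have "U = L \<circ> L \<circ> L \<circ> L \<circ> L \<circ> S \<circ> L" by (simp add: fun_eq_iff U_def)
  then show ?thesis using bij_L bij_S bij_comp by metis
qed

text \<open>Writing \<open>r\<close> for reversal, both sides become the word
  \<open>r L^2 r L^4\<close>: the left one by \<open>L6\<close>, the right one by
  \<open>rev_L4_rev\<close>.\<close>

lemma S_U: "S (U d) = U (S d)"
  by (simp add: U_def S_eq rev_L4_rev)

text \<open>The hexagonal relation: of the three translations in directions 60 degrees apart, the
  middle one is the sum of the outer two. It expresses \<open>L S L^-1\<close> as
  \<open>U^-1 S\<close>.\<close>

lemma U_L_S: "U (L (S d)) = S (L d)"
  by (simp add: U_def S_eq rev_L5_rev)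

lemma L_ipow_S: "L (ipow S k x) = ipow S k (ipow U (- k) (L x))"
proof -
  \<comment> \<open>\<open>V = L S L^-1\<close> is the third translation. As \<open>S = U V\<close>
    with commuting factors, \<open>V^k = U^-k S^k\<close>.\<close>
  define V where "V d = L (S (L (L (L (L (L d))))))" for d
  have "V = L \<circ> S \<circ> L \<circ> L \<circ> L \<circ> L \<circ> L" by (simp add: fun_eq_iff V_def)
  then have V: "bij V" using bij_L bij_S bij_comp by metis
  have UV: "S d = U (V d)" for d
    using U_L_S by (simp add: V_def)
  have "S (U d) = U (S d)" for d using S_U .
  then have VU: "U (V d) = V (U d)" for d
    using UV[of "U d"] UV[of d] bij_U by (metis bij_is_inj inj_eq)
  have "L (ipow S k x) = ipow V k (L x)"
    using bij_S V by (rule ipow_semiconj) (simp add: V_def)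
  also have "\<dots> = ipow U (- k + k) (ipow V k (L x))" by simp
  also have "\<dots> = ipow U (- k) (ipow S k (L x))"
    using ipow_comp[OF bij_U V bij_S VU UV, of k "L x"] bij_U by (simp only: ipow_add)
  also have "\<dots> = ipow S k (ipow U (- k) (L x))"
    using bij_U bij_S S_U by (intro ipow_commute) simp_all
  finally show ?thesis .
qed

section \<open>Coordinates of darts\<close>

lemma E_0 [simp]: "E t 0 0 = t"
  by (simp add: E_def)

text \<open>\<open>L U = S L\<close> and \<open>L S = U^-1 S L\<close>, so \<open>L\<close> acts on
  coordinates by a matrix of order 6, the rotation by 60 degrees.\<close>

lemma E_L: "L (E t k l) = E (L t) (k + l) (- k)"
proof -
  have "L (ipow U l t) = ipow S l (L t)"
    using bij_U bij_S by (rule ipow_semiconj) (simp add: L_U)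
  moreover have "ipow U (- k) (ipow S l (L t)) = ipow S l (ipow U (- k) (L t))"
    using bij_U bij_S S_U by (intro ipow_commute) simp_all
  ultimately show ?thesis
    using bij_S by (simp add: E_def L_ipow_S ipow_add)
qed

lemma E_S: "S (E t k l) = E t (k + 1) l"
  using bij_S by (simp add: E_def ipow_Suc)

lemma E_E: "E (E t k l) k' l' = E t (k' + k) (l' + l)"
proof -
  have "ipow U l' (ipow S k (ipow U l t)) = ipow S k (ipow U l' (ipow U l t))"
    using bij_U bij_S S_U by (intro ipow_commute) simp_all
  then show ?thesis
    using bij_S bij_U by (simp add: E_def ipow_add)
qed

lemma ipow_in_D:
  assumes "bij f" "\<And>d. f d \<in> D \<longleftrightarrow> d \<in> D"
  shows "ipow f k d \<in> D \<longleftrightarrow> d \<in> D"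
proof (induct k rule: int_induct[where k = 0])
  case (step1 i)
  then show ?case using assms by (simp add: ipow_Suc)
next
  case (step2 i)
  then show ?case using assms(2)[of "ipow f (i - 1) d"] assms(1) by (simp add: ipow_pred)
qed simp

lemma E_in_D [simp]: "E t k l \<in> D \<longleftrightarrow> t \<in> D"
proof -
  have S: "S d \<in> D \<longleftrightarrow> d \<in> D" for d by (simp add: S_eq)
  have U: "U d \<in> D \<longleftrightarrow> d \<in> D" for d by (simp add: U_def S_eq)
  show ?thesis
    unfolding E_def ipow_in_D[OF bij_S S] ipow_in_D[OF bij_U U] ..
qed

text \<open>Translations form a commutative group, so every equality within one class is a question
  about the periods of \<open>t\<close>.\<close>

lemma E_eq_iff: "E t k l = E t k' l' \<longleftrightarrow> E t (k - k') (l - l') = t"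
proof -
  have "E t k l = E (E t (k - k') (l - l')) k' l'"
    by (simp add: E_E)
  moreover have "E t (k - k') (l - l') = E (E t k l) (- k') (- l')"
    by (simp add: E_E)
  moreover have "t = E (E t k' l') (- k') (- l')"
    by (simp add: E_E)
  ultimately show ?thesis by metis
qed

end

locale triangle_map = type_3_map +
  fixes T
  assumes T: "T \<in> triangles M"
begin

section \<open>The darts of a triangle as origins\<close>

lemma T_subset_D: "t \<in> T \<Longrightarrow> t \<in> D"
  using T face_subset_D by (auto simp: triangles_def faces_def)

lemma T_eq_face:
  assumes "t \<in> T"
  shows "face M t = T"
proof -
  obtain d where "d \<in> D" "T = face M d"
    using T by (auto simp: triangles_def faces_def)
  then show ?thesis
    using assms T_subset_D face_eq_iff by metis
qed

lemma LLL_T [simp]: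
  assumes "t \<in> T"
  shows "L (L (L t)) = t"
proof -
  have "card (face M t) = 3"
    using T T_eq_face[OF assms] by (simp add: triangles_def)
  then show ?thesis
    using card_face_eq_3 T_subset_D[OF assms] by blast
qed

lemma T_eq:
  assumes "t \<in> T"
  shows "T = {t, L t, L (L t)}"
  using face_eq[OF T_subset_D[OF assms]] T_eq_face[OF assms] LLL_T[OF assms] by auto

lemma L_in_T [simp]: "t \<in> T \<Longrightarrow> L t \<in> T"
  using T_eq by blast

lemma T_distinct: "t \<in> T \<Longrightarrow> L t \<noteq> t" "t \<in> T \<Longrightarrow> L (L t) \<noteq> t"
  using L_L_neq T_subset_D by auto

lemma ex_T: "\<exists>t. t \<in> T"
proof -
  have "T \<noteq> {}" using T by (auto simp: triangles_def)
  then show ?thesis by blast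
qed

lemma finite_T [simp]: "finite T" and card_T: "card T = 3"
  using T by (auto simp: triangles_def card_ge_0_finite)

lemma E_LLL: "t \<in> T \<Longrightarrow> L (L (L (E t k l))) = E t (- k) (- l)"
  by (simp add: E_L)

text \<open>By definition \<open>S\<close> is reversal after the half-turn \<open>L^3\<close>, which
  by \<open>E_LLL\<close> is negation: reversing is negating and then going one step on.\<close>

lemma E_rev: "t \<in> T \<Longrightarrow> rev_dart (E t k l) = E t (1 - k) (- l)"
  using S_eq[of "E t (- k) (- l)"] by (simp add: E_LLL E_S)

lemma E_L_rev: "t \<in> T \<Longrightarrow> rev_dart (L (E t k l)) = L (E t (- k) (1 - l))"
  by (simp add: E_rev E_L algebra_simps)

lemma E_LL_rev: "t \<in> T \<Longrightarrow> rev_dart (L (L (E t k l))) = L (L (E t (- 1 - k) (1 - l)))"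
  by (simp add: E_rev E_L algebra_simps)

text \<open>
  Otherwise \<open>prod.swap\<close> would fix a dart: it acts on each of the three classes of darts as a
  half-turn about an edge midpoint, and these midpoints represent the odd classes modulo 2.
\<close>

lemma E_even:
  assumes t: "t \<in> T" and "E t k l = t"
  shows "even k \<and> even l"
proof (rule ccontr)
  assume "\<not> (even k \<and> even l)"
  then consider (a) "odd k" "even l" | (b) "even k" "odd l" | (c) "odd k" "odd l" by blast
  then show False
  proof cases
    case a
    then obtain i j where "k = 2 * i + 1" "l = 2 * j" by (auto elim!: oddE evenE)
    then have "rev_dart (E t (- i) (- j)) = E t (- i) (- j)"
      using assms by (simp add: E_rev) (subst E_eq_iff, simp add: algebra_simps)
    then show ?thesis using rev_dart_neq T_subset_D[OF t] by auto
  next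
    case b
    then obtain i j where "k = 2 * i" "l = 2 * j + 1" by (auto elim!: oddE evenE)
    then have "rev_dart (L (E t (- i) (- j))) = L (E t (- i) (- j))"
      using assms by (simp add: E_L_rev) (subst E_eq_iff, simp add: algebra_simps)
    then show ?thesis using rev_dart_neq T_subset_D[OF t] by (metis E_in_D L_in_D)
  next
    case c
    then obtain i j where "k = 2 * i + 1" "l = 2 * j + 1" by (auto elim!: oddE)
    then have "rev_dart (L (L (E t (- i - 1) (- j)))) = L (L (E t (- i - 1) (- j)))"
      using assms by (simp add: E_LL_rev) (subst E_eq_iff, simp add: algebra_simps)
    then show ?thesis using rev_dart_neq T_subset_D[OF t] by (metis E_in_D L_in_D)
  qed
qed

text \<open>If the classes of \<open>t\<close> and \<open>L t\<close> met, then \<open>L\<close>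
  would map some dart of the class of \<open>t\<close> to itself: a rotation by 60 degrees followed
  by any lattice translation has a fixed lattice point.\<close>

lemma E_neq_E_L:
  assumes "t \<in> T"
  shows "E t k l \<noteq> E (L t) k' l'"
proof
  assume "E t k l = E (L t) k' l'"
  then have "E t (i + k) (j + l) = E (L t) (i + k') (j + l')" for i j
    by (metis E_E)
  \<comment> \<open>The fixed point, obtained by solving \<open>i + k' = (i + k) + (j + l)\<close>
    and \<open>j + l' = - (i + k)\<close> for \<open>i\<close> and \<open>j\<close>. The solution is
    integral because the rotation minus the identity has determinant 1.\<close>
  from this[of "l - l' - k'" "k' - k - l"]
  have "E t (l - l' - k' + k) (k' - k) = E (L t) (l - l') (k' - k - l + l')"
    by (simp add: algebra_simps)
  also have "\<dots> = L (E t (l - l' - k' + k) (k' - k))"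
    by (simp add: E_L algebra_simps)
  finally have "E t (l - l' - k' + k) (k' - k) = L (E t (l - l' - k' + k) (k' - k))" .
  then show False
    using L_neq T_subset_D[OF assms] by (metis E_in_D)
qed

lemma E_eq_imp_eq:
  assumes "t \<in> T" "t' \<in> T" "E t k l = E t' k' l'"
  shows "t = t'"
proof (rule ccontr)
  assume "t \<noteq> t'"
  with assms(1,2) have "t' = L t \<or> t = L t'"
    using T_eq[of t] LLL_T[of t] by auto
  then show False
    using E_neq_E_L assms by metis
qed

lemma D_eq: "D = {E t k l | t k l. t \<in> T}"
proof (rule closed_set_eq_D[symmetric])
  show "{E t k l |t k l. t \<in> T} \<noteq> {}" using ex_T by fast
  show "{E t k l |t k l. t \<in> T} \<subseteq> D" using T_subset_D by auto
  fix d assume "d \<in> {E t k l |t k l. t \<in> T}"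
  then obtain t k l where t: "t \<in> T" and d: "d = E t k l" by blast
  show "L d \<in> {E t k l |t k l. t \<in> T}"
    unfolding d E_L using L_in_T[OF t] by blast
  show "rev_dart d \<in> {E t k l |t k l. t \<in> T}"
    unfolding d E_rev[OF t] using t by blast
qed

end


section \<open>Rows of darts\<close>

text \<open>A nonzero subgroup of the integers is generated by its least positive element, here an
  even number. The values of \<open>P\<close> are the periods in one coordinate.\<close>

lemma int_even_subgroup:
  fixes P :: "int \<Rightarrow> bool"
  assumes diff: "\<And>j k. P j \<Longrightarrow> P k \<Longrightarrow> P (j - k)" and "P k0" "0 < k0" and even: "\<And>k. P k \<Longrightarrow> even k"
  shows "\<exists>m > 0. \<forall>k. P k \<longleftrightarrow> 2 * int m dvd k"
proof -
  have P0: "P 0" using diff[OF \<open>P k0\<close> \<open>P k0\<close>] by simp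
  have neg: "P (- k)" if "P k" for k using diff[OF P0 that] by simp
  have add: "P (j + k)" if "P j" "P k" for j k using diff[OF that(1) neg[OF that(2)]] by simp
  define p where "p = (LEAST p. 0 < p \<and> P (int p))"
  have "0 < nat k0 \<and> P (int (nat k0))" using assms by simp
  then have "0 < p \<and> P (int p)" unfolding p_def by (rule LeastI)
  then have p: "0 < p" "P (int p)" by auto
  have least: "p \<le> j" if "0 < j \<and> P (int j)" for j
    unfolding p_def using that by (rule Least_le)
  have mult: "P (int p * j)" for j
  proof (induct j rule: int_induct[where k = 0])
    case (step1 i)
    then show ?case using add[OF _ p(2)] by (simp add: distrib_left)
  next
    case (step2 i)
    then show ?case using diff[OF _ p(2)] by (simp add: right_diff_distrib)
  qed (simp add: P0)
  have "P k \<longleftrightarrow> int p dvd k" for k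
  proof
    assume "P k"
    \<comment> \<open>The remainder of \<open>k\<close> modulo \<open>p\<close> is again in the
      subgroup and smaller than \<open>p\<close>, so it vanishes.\<close>
    have "P (k - int p * (k div int p))"
      using diff[OF \<open>P k\<close> mult] .
    then have "P (int (nat (k mod int p)))"
      using p(1) by (simp add: minus_mult_div_eq_mod)
    moreover have "0 \<le> k mod int p" "k mod int p < int p" using p(1) by simp_all
    ultimately have "\<not> 0 < nat (k mod int p)"
      using least[of "nat (k mod int p)"] by linarith
    with \<open>0 \<le> k mod int p\<close> show "int p dvd k" by (simp add: dvd_eq_mod_eq_0)
  next
    assume "int p dvd k"
    then obtain j where "k = int p * j" by (rule dvdE)
    then show "P k" using mult by simp
  qed
  moreover obtain m where m: "p = 2 * m" using even[OF p(2)] by (auto elim: evenE)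
  ultimately show ?thesis using p(1) by (intro exI[of _ m]) simp
qed

context triangle_map
begin

section \<open>The lattice of periods\<close>

lemma E_closed: "E t k l = t \<Longrightarrow> E t k' l' = t \<Longrightarrow> E t (k - k') (l - l') = t"
  using E_eq_iff[of t k l k' l'] by simp

text \<open>Pigeonhole: the multiples of \<open>(a, b)\<close> move \<open>t\<close> within the
  finite set \<open>D\<close>.\<close>

lemma ex_period:
  assumes "t \<in> T"
  shows "\<exists>i > 0. E t (a * i) (b * i) = t"
proof -
  define f where "f i = E t (a * int i) (b * int i)" for i
  have "range f \<subseteq> D"
    using T_subset_D[OF assms] by (auto simp: f_def)
  then have "\<not> inj f"
    using inj_on_finite[of f UNIV D] finite_D by auto
  then have "\<not> (\<forall>i j. i < j \<longrightarrow> f i \<noteq> f j)"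
    using linorder_injI[of f] by blast
  then obtain i j where "i < j" and f: "f j = f i"
    by force
  have "E t (a * (int j - int i)) (b * (int j - int i)) = t"
    using f unfolding f_def by (subst (asm) E_eq_iff) (simp add: right_diff_distrib)
  with \<open>i < j\<close> show ?thesis
    by (intro exI[of _ "int j - int i"]) simp
qed

text \<open>\<open>2 s\<close> generates the intersection of the period lattice with the first axis
  and \<open>2 m\<close> (in \<open>m_of\<close>) generates its projection to the second coordinate;
  the factors 2 come from \<open>E_even\<close>. Later \<open>s\<close> becomes the length of the
  pseudo-road and \<open>m\<close> the number of concentric zigzags.\<close>

definition s_of :: "'a \<times> 'a \<Rightarrow> nat" where
  "s_of t = (SOME s. s > 0 \<and> (\<forall>k. E t k 0 = t \<longleftrightarrow> 2 * int s dvd k))"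

definition m_of :: "'a \<times> 'a \<Rightarrow> nat" where
  "m_of t = (SOME m. m > 0 \<and> (\<forall>l. (\<exists>k. E t k l = t) \<longleftrightarrow> 2 * int m dvd l))"

lemma s_of:
  assumes "t \<in> T"
  shows "s_of t > 0" "E t k 0 = t \<longleftrightarrow> 2 * int (s_of t) dvd k"
proof -
  obtain i where i: "i > 0" "E t i 0 = t" using ex_period[OF assms, of 1 0] by auto
  have "\<exists>s > 0. \<forall>k. E t k 0 = t \<longleftrightarrow> 2 * int s dvd k"
  proof (rule int_even_subgroup[where P = "\<lambda>k. E t k 0 = t", OF _ i(2,1)])
    show "E t (j - k) 0 = t" if "E t j 0 = t" "E t k 0 = t" for j k
      using E_closed[OF that] by simp
    show "even k" if "E t k 0 = t" for k
      using E_even[OF assms that] by simp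
  qed
  then have "s_of t > 0 \<and> (\<forall>k. E t k 0 = t \<longleftrightarrow> 2 * int (s_of t) dvd k)"
    unfolding s_of_def by (rule someI_ex)
  then show "s_of t > 0" "E t k 0 = t \<longleftrightarrow> 2 * int (s_of t) dvd k" by simp_all
qed

lemma m_of:
  assumes "t \<in> T"
  shows "m_of t > 0" "(\<exists>k. E t k l = t) \<longleftrightarrow> 2 * int (m_of t) dvd l"
proof -
  obtain i where i: "i > 0" "\<exists>k. E t k i = t" using ex_period[OF assms, of 0 1] by auto
  have "\<exists>m > 0. \<forall>l. (\<exists>k. E t k l = t) \<longleftrightarrow> 2 * int m dvd l"
  proof (rule int_even_subgroup[where P = "\<lambda>l. \<exists>k. E t k l = t", OF _ i(2,1)])
    fix l l' assume "\<exists>k. E t k l = t" "\<exists>k. E t k l' = t"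
    then obtain k k' where "E t k l = t" "E t k' l' = t" by auto
    from E_closed[OF this] show "\<exists>k. E t k (l - l') = t" by (rule exI)
  next
    show "even l" if "\<exists>k. E t k l = t" for l
      using that E_even[OF assms] by auto
  qed
  then have "m_of t > 0 \<and> (\<forall>l. (\<exists>k. E t k l = t) \<longleftrightarrow> 2 * int (m_of t) dvd l)"
    unfolding m_of_def by (rule someI_ex)
  then show "m_of t > 0" "(\<exists>k. E t k l = t) \<longleftrightarrow> 2 * int (m_of t) dvd l" by simp_all
qed

lemma E_same_row: "t \<in> T \<Longrightarrow> E t k l = E t k' l \<longleftrightarrow> 2 * int (s_of t) dvd k - k'"
  by (subst E_eq_iff) (simp add: s_of)

section \<open>Rows and translation classes\<close>

definition row :: "'a \<times> 'a \<Rightarrow> int \<Rightarrow> ('a \<times> 'a) set" where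
  "row t l = range (\<lambda>k. E t k l)"

lemma E_in_row [intro, simp]: "E t k l \<in> row t l"
  by (simp add: row_def)

lemma rowE:
  assumes "y \<in> row t l"
  obtains k where "y = E t k l"
  using assms by (auto simp: row_def)

text \<open>A row takes up all first coordinates, so only the projection of the period lattice to
  the second coordinate matters. Going once around by \<open>2 m\<close> rows may well shift the
  first coordinate.\<close>

lemma mem_row_iff:
  assumes "t \<in> T" "t' \<in> T"
  shows "E t k l \<in> row t' l' \<longleftrightarrow> t = t' \<and> 2 * int (m_of t) dvd l - l'"
proof -
  have "E t k l \<in> row t l' \<longleftrightarrow> (\<exists>k'. E t (k - k') (l - l') = t)"
    by (auto simp: row_def image_iff E_eq_iff[of t k l])
  also have "\<dots> \<longleftrightarrow> (\<exists>k'. E t k' (l - l') = t)"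
  proof
    assume "\<exists>k'. E t k' (l - l') = t"
    then obtain k' where "E t (k - (k - k')) (l - l') = t" by auto
    then show "\<exists>k'. E t (k - k') (l - l') = t" by (rule exI)
  next
    assume "\<exists>k'. E t (k - k') (l - l') = t"
    then obtain k' where "E t (k - k') (l - l') = t" by auto
    then show "\<exists>k'. E t k' (l - l') = t" by (rule exI)
  qed
  also have "\<dots> \<longleftrightarrow> 2 * int (m_of t) dvd l - l'"
    by (rule m_of(2)[OF assms(1)])
  finally have "E t k l \<in> row t l' \<longleftrightarrow> 2 * int (m_of t) dvd l - l'" .
  moreover have "t = t'" if "E t k l \<in> row t' l'"
  proof -
    obtain k' where "E t k l = E t' k' l'" using \<open>E t k l \<in> row t' l'\<close> by (rule rowE)
    then show ?thesis by (rule E_eq_imp_eq[OF assms])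
  qed
  ultimately show ?thesis by auto
qed

lemma row_subset_D: "t \<in> T \<Longrightarrow> row t l \<subseteq> D"
  using T_subset_D[of t] by (auto elim!: rowE)

lemma row_eq_iff:
  assumes "t \<in> T" "t' \<in> T"
  shows "row t l = row t' l' \<longleftrightarrow> t = t' \<and> 2 * int (m_of t) dvd l - l'"
proof
  assume "row t l = row t' l'"
  then have "E t 0 l \<in> row t' l'" by auto
  then show "t = t' \<and> 2 * int (m_of t) dvd l - l'"
    unfolding mem_row_iff[OF assms] .
next
  have sub: "row t i \<subseteq> row t j" if "2 * int (m_of t) dvd i - j" for i j
    using that mem_row_iff[OF assms(1,1)] by (metis rowE subsetI)
  assume "t = t' \<and> 2 * int (m_of t) dvd l - l'"
  then show "row t l = row t' l'"
    using sub[of l l'] sub[of l' l] dvd_diff_commute by blast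
qed

lemma row_disjoint:
  assumes "t \<in> T" "t' \<in> T" "row t l \<noteq> row t' l'"
  shows "row t l \<inter> row t' l' = {}"
proof -
  have "y \<notin> row t' l'" if "y \<in> row t l" for y
    using that mem_row_iff[OF assms(1,2)] row_eq_iff[OF assms(1,2)] assms(3) by (metis rowE)
  then show ?thesis by blast
qed

lemma row_eq_image:
  assumes "t \<in> T"
  shows "row t l = (\<lambda>k. E t k l) ` {0..<2 * int (s_of t)}"
proof
  show "row t l \<subseteq> (\<lambda>k. E t k l) ` {0..<2 * int (s_of t)}"
  proof
    fix y assume "y \<in> row t l"
    then obtain k where "y = E t k l" by (rule rowE)
    then have "y = E t (k mod (2 * int (s_of t))) l"
      using E_same_row[OF assms] by (simp add: mod_eq_dvd_iff[symmetric])
    then show "y \<in> (\<lambda>k. E t k l) ` {0..<2 * int (s_of t)}"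
      using s_of(1)[OF assms] by auto
  qed
qed auto

lemma inj_on_E: "t \<in> T \<Longrightarrow> inj_on (\<lambda>k. E t k l) {0..<2 * int (s_of t)}"
  by (auto simp: inj_on_def E_same_row mod_eq_dvd_iff[symmetric])

lemma card_row: "t \<in> T \<Longrightarrow> card (row t l) = 2 * s_of t"
  by (simp add: row_eq_image inj_on_E card_image)

lemma finite_row [simp]: "t \<in> T \<Longrightarrow> finite (row t l)"
  using card_row s_of(1) by (metis card_ge_0_finite mult_pos_pos zero_less_numeral)

text \<open>The orbit of \<open>t\<close> under translations. Reversal preserves the three classes
  and \<open>L\<close> permutes them cyclically.\<close>

definition dart_class :: "'a \<times> 'a \<Rightarrow> ('a \<times> 'a) set" where
  "dart_class t = (\<Union>l. row t l)"

lemma E_in_class [simp]: "E t k l \<in> dart_class t"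
  by (auto simp: dart_class_def)

lemma classE:
  assumes "d \<in> dart_class t"
  obtains k l where "d = E t k l"
  using assms by (auto simp: dart_class_def elim: rowE)

lemma class_disjoint:
  assumes "t \<in> T" "t' \<in> T" "d \<in> dart_class t" "d \<in> dart_class t'"
  shows "t = t'"
proof -
  obtain k l where d: "d = E t k l" using assms(3) by (rule classE)
  obtain k' l' where d': "d = E t' k' l'" using assms(4) by (rule classE)
  have "E t k l = E t' k' l'" using d d' by simp
  then show ?thesis by (rule E_eq_imp_eq[OF assms(1,2)])
qed

lemma ex_class:
  assumes "d \<in> D"
  shows "\<exists>t\<in>T. d \<in> dart_class t"
proof -
  obtain t k l where "d = E t k l" "t \<in> T"
    using assms D_eq by auto
  then show ?thesis by (intro bexI[of _ t]) simp_all
qed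

lemma L_in_class:
  assumes "t \<in> T"
  shows "L d \<in> dart_class (L t) \<longleftrightarrow> d \<in> dart_class t"
proof
  assume "L d \<in> dart_class (L t)"
  then obtain k l where "L d = E (L t) k l" by (rule classE)
  also have "\<dots> = L (E t (- l) (k + l))" by (simp add: E_L)
  finally show "d \<in> dart_class t" by simp
next
  assume "d \<in> dart_class t"
  then obtain k l where "d = E t k l" by (rule classE)
  then show "L d \<in> dart_class (L t)" by (simp add: E_L)
qed

lemma rev_in_class:
  assumes "t \<in> T" "d \<in> dart_class t"
  shows "rev_dart d \<in> dart_class t"
proof -
  obtain k l where "d = E t k l" using assms(2) by (rule classE)
  then show ?thesis using assms(1) by (simp add: E_rev)
qed

lemma rot_in_class: "t \<in> T \<Longrightarrow> d \<in> dart_class t \<Longrightarrow> rot M d \<in> dart_class (L t)"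
  by (simp add: rot_eq L_in_class rev_in_class)

text \<open>The three darts leaving a vertex are cyclically permuted by \<open>rot M\<close>, which
  is \<open>L\<close> after reversal and hence permutes the three classes cyclically: one of the
  darts lies in each class.\<close>

lemma bij_betw_class_vertices:
  assumes "t \<in> T"
  shows "bij_betw fst (dart_class t) (vertices M)"
proof (rule bij_betw_imageI)
  have D: "d \<in> D" if "d \<in> dart_class t" for d
    using that T_subset_D[OF assms] by (metis classE E_in_D)
  show "inj_on fst (dart_class t)"
  proof (rule inj_onI)
    fix d d' assume d: "d \<in> dart_class t" "d' \<in> dart_class t" "fst d = fst d'"
    then have "d' \<in> {d, rot M d, rot M (rot M d)}"
      by (metis same_tail D)
    moreover have "rot M d \<in> dart_class (L t)" "rot M (rot M d) \<in> dart_class (L (L t))"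
      using rot_in_class[OF assms d(1)] rot_in_class[OF L_in_T[OF assms]] by blast+
    moreover have "d' \<notin> dart_class (L t)" "d' \<notin> dart_class (L (L t))"
      using class_disjoint[OF assms _ d(2)] T_distinct[OF assms] assms L_in_T by metis+
    ultimately show "d = d'" by blast
  qed
  show "fst ` dart_class t = vertices M"
  proof
    show "vertices M \<subseteq> fst ` dart_class t"
    proof
      fix v assume "v \<in> vertices M"
      then have "{d \<in> D. fst d = v} \<noteq> {}"
        using card_out[of v] by (metis card.empty zero_neq_numeral)
      then obtain d where d: "d \<in> D" "fst d = v" by blast
      obtain t' where t': "t' \<in> T" "d \<in> dart_class t'" using ex_class[OF d(1)] by blast
      have "rot M d \<in> dart_class (L t')" "rot M (rot M d) \<in> dart_class (L (L t'))"
        using rot_in_class[OF t'] rot_in_class[OF L_in_T[OF t'(1)]] by blast+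
      moreover have "fst (rot M d) = v" "fst (rot M (rot M d)) = v"
        using d by simp_all
      moreover have "t = t' \<or> t = L t' \<or> t = L (L t')" using T_eq[OF t'(1)] assms by blast
      ultimately show "v \<in> fst ` dart_class t"
        using d(2) t'(2) by (metis imageI)
    qed
    show "fst ` dart_class t \<subseteq> vertices M"
      using D arc_fst_in_verts by blast
  qed
qed

text \<open>The class of \<open>t\<close> consists of \<open>2 m\<close> disjoint rows of
  \<open>2 s\<close> darts and has one dart per vertex.\<close>

lemma n_eq:
  assumes "t \<in> T"
  shows "n = 4 * s_of t * m_of t"
proof -
  have "dart_class t = (\<Union>l\<in>{0..<2 * int (m_of t)}. row t l)"
  proof
    show "dart_class t \<subseteq> (\<Union>l\<in>{0..<2 * int (m_of t)}. row t l)"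
    proof
      fix d assume "d \<in> dart_class t"
      then obtain k l where "d = E t k l" by (rule classE)
      then have "d \<in> row t (l mod (2 * int (m_of t)))"
        by (simp only: mem_row_iff[OF assms assms] dvd_minus_mod simp_thms)
      then show "d \<in> (\<Union>l\<in>{0..<2 * int (m_of t)}. row t l)"
        using m_of(1)[OF assms] by auto
    qed
  qed (auto simp: dart_class_def)
  moreover have "card (\<Union>l\<in>{0..<2 * int (m_of t)}. row t l) = (\<Sum>l\<in>{0..<2 * int (m_of t)}. card (row t l))"
  proof (rule card_UN_disjoint)
    show "\<forall>i\<in>{0..<2 * int (m_of t)}. \<forall>j\<in>{0..<2 * int (m_of t)}. i \<noteq> j \<longrightarrow> row t i \<inter> row t j = {}"
    proof (intro ballI impI)
      fix i j assume "i \<in> {0..<2 * int (m_of t)}" "j \<in> {0..<2 * int (m_of t)}" "i \<noteq> j"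
      then have "\<not> 2 * int (m_of t) dvd i - j"
        by (simp flip: mod_eq_dvd_iff)
      then show "row t i \<inter> row t j = {}"
        using row_disjoint[OF assms assms] row_eq_iff[OF assms assms] by blast
    qed
  qed (use assms in auto)
  ultimately have "card (dart_class t) = 4 * s_of t * m_of t"
    by (simp add: card_row assms nat_mult_distrib)
  then show ?thesis
    using bij_betw_same_card[OF bij_betw_class_vertices[OF assms]] card_vertices by simp
qed

lemma S_in_row: "y \<in> row t l \<Longrightarrow> S y \<in> row t l"
  by (metis rowE E_S E_in_row)

lemma orbit_S:
  assumes "t \<in> T" "y \<in> row t l"
  shows "orbit S y = row t l"
proof
  show "orbit S y \<subseteq> row t l"
  proof
    fix x assume "x \<in> orbit S y"
    then show "x \<in> row t l"
      by induct (simp_all add: assms(2) S_in_row)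
  qed
  show "row t l \<subseteq> orbit S y"
  proof
    fix x assume "x \<in> row t l"
    then obtain k' where x: "x = E t k' l" by (rule rowE)
    obtain k where y: "y = E t k l" using assms(2) by (rule rowE)
    have iter: "E t (k + 1 + int i) l \<in> orbit S y" for i
    proof (induct i)
      case 0
      then show ?case unfolding y using orbit.base[of S "E t k l"] by (simp add: E_S)
    next
      case (Suc i)
      then show ?case using orbit.step[of "E t (k + 1 + int i) l" S y] by (simp add: E_S algebra_simps)
    qed
    \<comment> \<open>Orbits are made of positive iterates, so a dart lying behind \<open>y\<close>
      is reached by going around: a nonnegative number of steps beyond the first, found modulo the
      period \<open>2 s\<close>.\<close>
    define i where "i = (k' - k - 1) mod (2 * int (s_of t))"
    have "0 \<le> i" using s_of(1)[OF assms(1)] by (simp add: i_def)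
    moreover have "2 * int (s_of t) dvd (k + 1 + i) - k'"
    proof -
      have "2 * int (s_of t) dvd i - (k' - k - 1)"
        by (simp add: i_def mod_eq_dvd_iff[symmetric])
      then show ?thesis by (simp add: algebra_simps)
    qed
    ultimately have "E t (k + 1 + int (nat i)) l = x"
      by (simp add: x E_same_row[OF assms(1)])
    then show "x \<in> orbit S y"
      using iter[of "nat i"] by simp
  qed
qed

end


section \<open>Zigzags along rows\<close>

lemma edge_of_eq_iff: "edge_of a = edge_of b \<longleftrightarrow> a = b \<or> a = prod.swap b"
  by (cases a; cases b) (auto simp: edge_of_def doubleton_eq_iff)

text \<open>Each of the \<open>c\<close> blocks of length \<open>q\<close> contains one
  solution.\<close>

lemma card_residue_class:
  fixes a q :: int
  assumes "q > 0"
  shows "card {k \<in> {0..<q * int c}. q dvd k + a} = c"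
proof -
  define r where "r = (- a) mod q"
  have r: "0 \<le> r" "r < q" using assms by (simp_all add: r_def)
  have dvd: "q dvd k + a \<longleftrightarrow> k mod q = r" for k
    unfolding r_def mod_eq_dvd_iff by simp
  have "{k \<in> {0..<q * int c}. q dvd k + a} = (\<lambda>i. q * int i + r) ` {..<c}"
  proof (intro equalityI subsetI)
    fix k assume "k \<in> {k \<in> {0..<q * int c}. q dvd k + a}"
    then have k: "0 \<le> k" "k < q * int c" "k mod q = r" by (simp_all add: dvd)
    then have "k = q * (k div q) + r" by (metis mult_div_mod_eq)
    moreover have "0 \<le> k div q" using k assms by (simp add: pos_imp_zdiv_nonneg_iff)
    moreover have "k div q < int c"
    proof (rule ccontr)
      assume "\<not> k div q < int c"
      then have "q * int c \<le> q * (k div q)" using assms by (intro mult_left_mono) simp_all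
      with \<open>k = q * (k div q) + r\<close> k(2) r(1) show False by linarith
    qed
    ultimately show "k \<in> (\<lambda>i. q * int i + r) ` {..<c}"
      by (intro image_eqI[of _ _ "nat (k div q)"]) auto
  next
    fix k assume "k \<in> (\<lambda>i. q * int i + r) ` {..<c}"
    then obtain i where i: "i < c" "k = q * int i + r" by auto
    then have "q * (int i + 1) \<le> q * int c"
      using assms by (intro mult_left_mono) simp_all
    then have "k < q * int c"
      using i r by (simp add: distrib_left)
    moreover have "k mod q = r" using i(2) r by simp
    ultimately show "k \<in> {k \<in> {0..<q * int c}. q dvd k + a}"
      using i r assms by (simp add: dvd)
  qed
  moreover have "inj_on (\<lambda>i. q * int i + r) {..<c}"
    using assms by (auto simp: inj_on_def)
  ultimately show ?thesis by (simp add: card_image)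
qed

context triangle_map
begin

text \<open>Entering a face through \<open>y\<close> and following its two edges \<open>L y\<close>
  and \<open>L (L y)\<close>, the turn to the right leads to the corresponding edge of the next
  face, entered through \<open>S y\<close>. So two steps of a zigzag amount to one step of
  \<open>S\<close>, and a zigzag runs along a single row.\<close>

lemma right_L_L: "right M (L (L y)) = L (S y)"
proof -
  have "rot M (L (S y)) = rev_dart (L (L y))"
    using rot_rot_rot[of "rev_dart (L (L y))"] by (simp add: rot_eq S_eq)
  then show ?thesis
    using permutes_inj[OF rot_permutes] by (simp add: right_def inv_f_eq)
qed

lemma zz_step_True: "zz_step M (L y, True) = (L (L y), False)"
  by (simp add: zz_step_def)

lemma zz_step_False: "zz_step M (L (L y), False) = (L (S y), True)"
  by (simp add: zz_step_def right_L_L)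

definition zz :: "'a \<times> 'a \<Rightarrow> int \<Rightarrow> (('a \<times> 'a) \<times> bool) set" where
  "zz t l = (\<lambda>y. (L y, True)) ` row t l \<union> (\<lambda>y. (L (L y), False)) ` row t l"

definition zz_darts :: "'a \<times> 'a \<Rightarrow> int \<Rightarrow> ('a \<times> 'a) set" where
  "zz_darts t l = L ` row t l \<union> L ` L ` row t l"

lemma fst_zz: "fst ` zz t l = zz_darts t l"
  by (simp add: zz_def zz_darts_def image_Un image_image)

lemma zz_True_iff: "(L y, True) \<in> zz t l \<longleftrightarrow> y \<in> row t l"
  by (auto simp: zz_def)

lemma zz_False_iff: "(L (L y), False) \<in> zz t l \<longleftrightarrow> y \<in> row t l"
  by (auto simp: zz_def)

lemma zz_cases:
  assumes "x \<in> zz t l"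
  obtains y where "y \<in> row t l" "x = (L y, True)" | y where "y \<in> row t l" "x = (L (L y), False)"
  using assms unfolding zz_def by blast

lemma zz_step_in_zz: "x \<in> zz t l \<Longrightarrow> zz_step M x \<in> zz t l"
  by (erule zz_cases) (simp_all add: zz_step_True zz_step_False zz_True_iff zz_False_iff S_in_row)

lemma orbit_zz_step:
  assumes "t \<in> T" "x \<in> zz t l"
  shows "orbit (zz_step M) x = zz t l"
proof -
  define y where "y = E t 0 l"
  have "orbit (zz_step M) (L y, True) = zz t l"
  proof
    show "orbit (zz_step M) (L y, True) \<subseteq> zz t l"
    proof
      fix x assume "x \<in> orbit (zz_step M) (L y, True)"
      then show "x \<in> zz t l"
        by induct (simp_all add: zz_step_in_zz zz_True_iff y_def)
    qed
    have True: "(L y', True) \<in> orbit (zz_step M) (L y, True)" if "y' \<in> row t l" for y'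
    proof -
      have "y' \<in> orbit S y" using orbit_S[OF assms(1), of y l] that by (simp add: y_def)
      then show ?thesis
      proof induct
        case base
        show ?case
          using orbit.step[OF orbit.base[of "zz_step M" "(L y, True)"]]
          by (simp add: zz_step_True zz_step_False)
      next
        case (step z)
        show ?case
          using orbit.step[OF orbit.step[OF step(2)]]
          by (simp add: zz_step_True zz_step_False)
      qed
    qed
    show "zz t l \<subseteq> orbit (zz_step M) (L y, True)"
    proof
      fix x assume "x \<in> zz t l"
      then show "x \<in> orbit (zz_step M) (L y, True)"
      proof (cases rule: zz_cases)
        case (2 z)
        then show ?thesis using orbit.step[OF True[OF 2(1)]] by (simp add: zz_step_True)
      qed (simp add: True)
    qed
  qed
  then have "cyclic_on (zz_step M) (zz t l)"
    by (intro cyclic_on_singleI[of "(L y, True)"]) (simp_all add: zz_True_iff y_def)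
  then show ?thesis using assms(2) by (rule orbit_cyclic_eq3)
qed

lemma oriented_zigzags_eq: "oriented_zigzags M = (\<lambda>(t, l). zz t l) ` (T \<times> UNIV)"
proof (intro equalityI subsetI)
  fix W assume "W \<in> oriented_zigzags M"
  then obtain d b where d: "d \<in> D" "W = orbit (zz_step M) (d, b)"
    by (auto simp: oriented_zigzags_def)
  \<comment> \<open>This is \<open>L^-1 d\<close> or \<open>L^-2 d\<close>, by \<open>L6\<close>, so
    that \<open>(d, b)\<close> becomes the first or second state at the face entered through
    \<open>y\<close>.\<close>
  define y where "y = (if b then L (L (L (L (L d)))) else L (L (L (L d))))"
  have "y \<in> D" using d(1) by (simp add: y_def)
  then obtain t k l where t: "t \<in> T" and y: "y = E t k l" using D_eq by auto
  have "(d, b) \<in> zz t l"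
  proof (cases b)
    case True
    have "(L y, True) \<in> zz t l" unfolding zz_True_iff y by simp
    with True show ?thesis by (simp add: y_def)
  next
    case False
    have "(L (L y), False) \<in> zz t l" unfolding zz_False_iff y by simp
    with False show ?thesis by (simp add: y_def)
  qed
  then have "W = zz t l" using orbit_zz_step[OF t] d(2) by simp
  with t show "W \<in> (\<lambda>(t, l). zz t l) ` (T \<times> UNIV)"
    by (intro image_eqI[of _ _ "(t, l)"]) simp_all
next
  fix W assume "W \<in> (\<lambda>(t, l). zz t l) ` (T \<times> UNIV)"
  then obtain t l where t: "t \<in> T" "W = zz t l" by auto
  have "W = orbit (zz_step M) (L (E t 0 l), True)"
    using orbit_zz_step[OF t(1), of "(L (E t 0 l), True)" l] t(2) by (simp add: zz_True_iff)
  moreover have "(L (E t 0 l), True) \<in> D \<times> UNIV"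
    using T_subset_D[OF t(1)] by simp
  ultimately show "W \<in> oriented_zigzags M"
    unfolding oriented_zigzags_def by (rule image_eqI)
qed

section \<open>Reversal and simplicity of zigzags\<close>

lemma rev_L_row:
  assumes "t \<in> T" "y \<in> row t l"
  shows "\<exists>z\<in>row t (1 - l). rev_dart (L y) = L z"
proof -
  obtain k where "y = E t k l" using assms(2) by (rule rowE)
  then have "rev_dart (L y) = L (E t (- k) (1 - l))"
    using E_L_rev[OF assms(1)] by simp
  then show ?thesis by (intro bexI[of _ "E t (- k) (1 - l)"]) simp_all
qed

lemma rev_L_L_row:
  assumes "t \<in> T" "y \<in> row t l"
  shows "\<exists>z\<in>row t (1 - l). rev_dart (L (L y)) = L (L z)"
proof -
  obtain k where "y = E t k l" using assms(2) by (rule rowE)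
  then have "rev_dart (L (L y)) = L (L (E t (- 1 - k) (1 - l)))"
    using E_LL_rev[OF assms(1)] by simp
  then show ?thesis by (intro bexI[of _ "E t (- 1 - k) (1 - l)"]) simp_all
qed

lemma zz_reverse_subset:
  assumes "t \<in> T"
  shows "zz_reverse (zz t l) \<subseteq> zz t (1 - l)"
proof
  fix x assume "x \<in> zz_reverse (zz t l)"
  then obtain a b where x: "x = (rev_dart a, b)" and "(a, b) \<in> zz t l"
    unfolding zz_reverse_def by auto
  from this(2) show "x \<in> zz t (1 - l)"
  proof (cases rule: zz_cases)
    case (1 y)
    then show ?thesis using rev_L_row[OF assms 1(1)] x by (auto simp: zz_True_iff)
  next
    case (2 y)
    then show ?thesis using rev_L_L_row[OF assms 2(1)] x by (auto simp: zz_False_iff)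
  qed
qed

text \<open>The inclusion for \<open>l\<close> and for \<open>1 - l\<close> is enough, since
  reversal is an involution.\<close>

lemma zz_reverse_zz:
  assumes "t \<in> T"
  shows "zz_reverse (zz t l) = zz t (1 - l)"
proof -
  have involution: "zz_reverse (zz_reverse W) = W" for W :: "(('a \<times> 'a) \<times> bool) set"
    by (force simp: zz_reverse_def image_image)
  have "zz_reverse (zz t (1 - l)) \<subseteq> zz t l"
    using zz_reverse_subset[OF assms, of "1 - l"] by simp
  then have "zz_reverse (zz_reverse (zz t (1 - l))) \<subseteq> zz_reverse (zz t l)"
    unfolding zz_reverse_def by (rule image_mono)
  then show ?thesis
    using zz_reverse_subset[OF assms, of l] by (simp only: involution subset_antisym)
qed

lemma rev_zz_darts:
  assumes "t \<in> T" "a \<in> zz_darts t l"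
  shows "rev_dart a \<in> zz_darts t (1 - l)"
proof -
  obtain x where "x \<in> zz t l" "a = fst x"
    using assms(2) fst_zz[of t l] by blast
  then have "(rev_dart a, snd x) \<in> zz_reverse (zz t l)"
    unfolding zz_reverse_def by (intro image_eqI[of _ _ x]) (simp_all add: case_prod_beta)
  then have "fst (rev_dart a, snd x) \<in> fst ` zz t (1 - l)"
    unfolding zz_reverse_zz[OF assms(1)] by (rule imageI)
  then show ?thesis by (simp add: fst_zz)
qed

lemma row_subset_class: "row t l \<subseteq> dart_class t"
  by (auto simp: dart_class_def)

lemma class_neq:
  "t \<in> T \<Longrightarrow> t' \<in> T \<Longrightarrow> t \<noteq> t' \<Longrightarrow> d \<in> dart_class t \<Longrightarrow> d' \<in> dart_class t' \<Longrightarrow> d \<noteq> d'"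
  using class_disjoint by blast

lemma L_row_disjoint_L_L_row:
  assumes "t \<in> T" "y \<in> row t l" "z \<in> row t l'"
  shows "L y \<noteq> L (L z)"
proof
  assume "L y = L (L z)"
  then have "y = L z" by simp
  moreover have "L z \<in> dart_class (L t)" "y \<in> dart_class t"
    using row_subset_class assms L_in_class[OF assms(1)] by blast+
  ultimately show False
    using class_disjoint[of t "L t" y] T_distinct(1)[OF assms(1)] assms(1) by simp
qed

lemma zz_darts_disjoint:
  assumes "t \<in> T" "\<not> 2 * int (m_of t) dvd l - l'"
  shows "zz_darts t l \<inter> zz_darts t l' = {}"
proof -
  have "row t l \<inter> row t l' = {}"
    using row_disjoint[OF assms(1,1)] row_eq_iff[OF assms(1,1)] assms(2) by blast
  then have "L y \<noteq> L z" "L (L y) \<noteq> L (L z)" if "y \<in> row t l" "z \<in> row t l'" for y z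
    using that by auto
  moreover have "L y \<noteq> L (L z)" "L (L y) \<noteq> L z" if "y \<in> row t l" "z \<in> row t l'" for y z
    using L_row_disjoint_L_L_row[OF assms(1) that] L_row_disjoint_L_L_row[OF assms(1) that(2,1)]
    by (simp_all del: L_eq_iff)
  ultimately show ?thesis
    unfolding zz_darts_def by blast
qed

text \<open>\<open>2 l - 1\<close> is odd, hence never a multiple of \<open>2 m\<close>: a zigzag
  does not meet its own reversal. This excludes self-intersections of type I.\<close>

lemma zz_darts_rev_disjoint:
  assumes "t \<in> T"
  shows "zz_darts t l \<inter> zz_darts t (1 - l) = {}"
proof (rule zz_darts_disjoint[OF assms])
  show "\<not> 2 * int (m_of t) dvd l - (1 - l)"
  proof
    assume "2 * int (m_of t) dvd l - (1 - l)"
    then have "2 dvd l - (1 - l)" by (rule dvd_mult_left)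
    then show False by presburger
  qed
qed

text \<open>Darts followed by a left turn lie in the class of \<open>L t\<close>, those followed by
  a right turn in the class of \<open>L (L t)\<close>. This excludes self-intersections of type
  II.\<close>

lemma inj_on_fst_zz:
  assumes "t \<in> T"
  shows "inj_on fst (zz t l)"
proof (rule inj_onI)
  fix x x' assume x: "x \<in> zz t l" "x' \<in> zz t l" "fst x = fst x'"
  note neq = L_row_disjoint_L_L_row[OF assms]
  from x(1) show "x = x'"
  proof (cases rule: zz_cases)
    case y: (1 y)
    from x(2) show ?thesis
    proof (cases rule: zz_cases)
      case (2 z)
      then show ?thesis using x(3) y neq[OF y(1) 2(1)] by simp
    qed (use x(3) y in simp)
  next
    case y: (2 y)
    from x(2) show ?thesis
    proof (cases rule: zz_cases)
      case (1 z)
      then show ?thesis using x(3) y neq[OF 1(1) y(1)] by simp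
    qed (use x(3) y in simp)
  qed
qed

lemma simple_zz:
  assumes "t \<in> T"
  shows "inj_on (edge_of \<circ> fst) (zz t l)"
proof (rule comp_inj_on[OF inj_on_fst_zz[OF assms]], unfold fst_zz, rule inj_onI)
  fix a b assume ab: "a \<in> zz_darts t l" "b \<in> zz_darts t l" "edge_of a = edge_of b"
  then have "a = b \<or> a = rev_dart b" by (simp add: edge_of_eq_iff)
  moreover have "rev_dart b \<noteq> a"
    using zz_darts_rev_disjoint[OF assms] rev_zz_darts[OF assms ab(2)] ab(1) by blast
  ultimately show "a = b" by blast
qed

lemma type_I_edges_zz:
  assumes "t \<in> T"
  shows "type_I_edges (zz t l) = {}"
proof -
  have "\<not> ((a, b) \<in> zz t l \<and> (rev_dart a, b') \<in> zz t l)" for a b b'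
  proof
    assume "(a, b) \<in> zz t l \<and> (rev_dart a, b') \<in> zz t l"
    then have "a \<in> zz_darts t l" "rev_dart a \<in> zz_darts t l"
      by (force simp flip: fst_zz)+
    then show False
      using rev_zz_darts[OF assms] zz_darts_rev_disjoint[OF assms] by blast
  qed
  then show ?thesis unfolding type_I_edges_def by blast
qed

lemma type_II_edges_zz:
  assumes "t \<in> T"
  shows "type_II_edges (zz t l) = {}"
proof -
  have "\<not> ((a, True) \<in> zz t l \<and> (a, False) \<in> zz t l)" for a
    using inj_onD[OF inj_on_fst_zz[OF assms, of l], of "(a, True)" "(a, False)"] by auto
  then show ?thesis unfolding type_II_edges_def by blast
qed

lemma card_zz_darts:
  assumes "t \<in> T"
  shows "card (zz_darts t l) = 4 * s_of t"
proof -
  have "inj_on L A" for A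
    by (simp add: inj_on_def)
  then have "card (L ` row t l) = 2 * s_of t" "card (L ` L ` row t l) = 2 * s_of t"
    using card_row[OF assms] by (simp_all add: card_image)
  moreover have "L ` row t l \<inter> L ` L ` row t l = {}"
    using L_row_disjoint_L_L_row[OF assms] by blast
  ultimately show ?thesis
    using finite_row[OF assms] by (simp add: zz_darts_def card_Un_disjoint)
qed

lemma card_zz: "t \<in> T \<Longrightarrow> card (zz t l) = 4 * s_of t"
  using card_zz_darts[of t l] card_image[OF inj_on_fst_zz[of t l]] by (simp add: fst_zz)

lemma zz_eq_iff:
  assumes "t \<in> T" "t' \<in> T"
  shows "zz t l = zz t' l' \<longleftrightarrow> t = t' \<and> 2 * int (m_of t) dvd l - l'"
proof
  assume "zz t l = zz t' l'"
  moreover have "(L (E t 0 l), True) \<in> zz t l" by (simp only: zz_True_iff E_in_row)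
  ultimately have "E t 0 l \<in> row t' l'" by (simp only: zz_True_iff)
  then show "t = t' \<and> 2 * int (m_of t) dvd l - l'" unfolding mem_row_iff[OF assms] .
next
  assume "t = t' \<and> 2 * int (m_of t) dvd l - l'"
  then have "row t l = row t' l'" unfolding row_eq_iff[OF assms] .
  then show "zz t l = zz t' l'" by (simp only: zz_def)
qed

section \<open>Zigzags up to direction and their number\<close>

definition zigzag :: "'a \<times> 'a \<Rightarrow> int \<Rightarrow> 'a zigzag" where
  "zigzag t l = {zz t l, zz t (1 - l)}"

lemma zigzags_eq: "zigzags M = (\<lambda>(t, l). zigzag t l) ` (T \<times> UNIV)"
  unfolding zigzags_def oriented_zigzags_eq image_image
  by (intro image_cong) (simp_all add: case_prod_beta mem_Times_iff zigzag_def zz_reverse_zz)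

lemma zigzag_eq_iff:
  assumes "t \<in> T" "t' \<in> T"
  shows "zigzag t l = zigzag t' l' \<longleftrightarrow>
    t = t' \<and> (2 * int (m_of t) dvd l - l' \<or> 2 * int (m_of t) dvd l + l' - 1)"
proof -
  have "(1 - l) - (1 - l') = - (l - l')" "l - (1 - l') = l + l' - 1" "(1 - l) - l' = - (l + l' - 1)"
    by simp_all
  then show ?thesis
    unfolding zigzag_def doubleton_eq_iff zz_eq_iff[OF assms]
    by (simp only: dvd_minus_iff) blast
qed

lemma zz_length_zigzag: "t \<in> T \<Longrightarrow> zz_length (zigzag t l) = 4 * s_of t"
  by (simp add: zz_length_def zigzag_def card_zz)

lemma signature_zigzag: "t \<in> T \<Longrightarrow> signature (zigzag t l) = (0, 0)"
  by (simp add: signature_def zigzag_def type_I_edges_zz type_II_edges_zz)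

lemma simple_zigzag_zigzag: "t \<in> T \<Longrightarrow> simple_zigzag (zigzag t l)"
  by (simp add: simple_zigzag_def zigzag_def simple_zz)

lemma zz_edges_zigzag:
  assumes "t \<in> T"
  shows "zz_edges (zigzag t l) = edge_of ` zz_darts t l"
proof -
  have "edge_of ` zz_darts t (1 - l) = edge_of ` rev_dart ` zz_darts t (1 - l)"
    by (simp add: image_image edge_of_def insert_commute)
  also have "\<dots> \<subseteq> edge_of ` zz_darts t l"
    using rev_zz_darts[OF assms, of _ "1 - l"] by (intro image_mono) auto
  finally have sub: "edge_of ` zz_darts t (1 - l) \<subseteq> edge_of ` zz_darts t l" .
  have "zz_edges (zigzag t l) = edge_of ` zz_darts t l \<union> edge_of ` zz_darts t (1 - l)"
    unfolding zz_edges_def zigzag_def fst_zz[symmetric] image_comp by simp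
  with sub show ?thesis by blast
qed

text \<open>Forgetting the direction identifies the residues \<open>l\<close> and
  \<open>1 - l\<close> modulo \<open>2 m\<close>. No residue is paired with itself, by parity, and
  \<open>1, ..., m\<close> contains exactly one member of each of the \<open>m\<close>
  pairs.\<close>

lemma bij_betw_zigzag:
  "bij_betw (\<lambda>(t, k). zigzag t (int k)) (SIGMA t:T. {1..m_of t}) (zigzags M)"
proof (rule bij_betw_imageI)
  show "inj_on (\<lambda>(t, k). zigzag t (int k)) (SIGMA t:T. {1..m_of t})"
  proof (rule inj_onI)
    fix x x'
    assume "x \<in> (SIGMA t:T. {1..m_of t})" "x' \<in> (SIGMA t:T. {1..m_of t})"
      and eq: "(\<lambda>(t, k). zigzag t (int k)) x = (\<lambda>(t, k). zigzag t (int k)) x'"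
    then obtain t k t' k' where x: "x = (t, k)" "x' = (t', k')"
      and t: "t \<in> T" "t' \<in> T" and k: "k \<in> {1..m_of t}" "k' \<in> {1..m_of t'}"
      by (elim SigmaE) simp
    have "zigzag t (int k) = zigzag t' (int k')" using eq x by simp
    then have "t = t' \<and> (2 * int (m_of t) dvd int k - int k' \<or> 2 * int (m_of t) dvd int k + int k' - 1)"
      unfolding zigzag_eq_iff[OF t] .
    then have tt: "t = t'"
      and *: "2 * int (m_of t) dvd int k - int k' \<or> 2 * int (m_of t) dvd int k + int k' - 1"
      by blast+
    from * have "k = k'"
    proof
      assume "2 * int (m_of t) dvd int k - int k'"
      moreover have "\<bar>int k - int k'\<bar> < 2 * int (m_of t)" using k tt by auto
      ultimately show ?thesis
        using dvd_imp_le_int[of "int k - int k'" "2 * int (m_of t)"] by linarith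
    next
      assume "2 * int (m_of t) dvd int k + int k' - 1"
      moreover have "0 < int k + int k' - 1" "int k + int k' - 1 < 2 * int (m_of t)" using k tt by auto
      ultimately show ?thesis
        using zdvd_not_zless[of "int k + int k' - 1" "2 * int (m_of t)"] by simp
    qed
    with tt x show "x = x'" by simp
  qed
  show "(\<lambda>(t, k). zigzag t (int k)) ` (SIGMA t:T. {1..m_of t}) = zigzags M"
  proof (intro equalityI subsetI)
    fix z assume "z \<in> zigzags M"
    then obtain t l where t: "t \<in> T" and z: "z = zigzag t l" using zigzags_eq by auto
    define r where "r = l mod (2 * int (m_of t))"
    have r: "0 \<le> r" "r < 2 * int (m_of t)" using m_of(1)[OF t] by (simp_all add: r_def)
    have dvd: "2 * int (m_of t) dvd l - r" unfolding r_def by (rule dvd_minus_mod)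
    \<comment> \<open>The residue 0 is paired with 1, and \<open>r\<close> above \<open>m\<close>
      with \<open>2 m + 1 - r\<close>.\<close>
    define k where "k = (if r = 0 then 1 else if r \<le> int (m_of t) then nat r else nat (2 * int (m_of t) + 1 - r))"
    have "2 * int (m_of t) dvd l - int k \<or> 2 * int (m_of t) dvd l + int k - 1"
    proof -
      consider "r = 0" | "0 < r" "r \<le> int (m_of t)" | "int (m_of t) < r" using r by linarith
      then show ?thesis
      proof cases
        case 3
        then have "l + int k - 1 = (l - r) + 2 * int (m_of t)" using r by (simp add: k_def)
        moreover have "2 * int (m_of t) dvd (l - r) + 2 * int (m_of t)"
          using dvd by (rule dvd_add) simp
        ultimately have "2 * int (m_of t) dvd l + int k - 1" by (simp only:)
        then show ?thesis ..
      qed (use dvd in \<open>simp_all add: k_def\<close>)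
    qed
    then have "z = zigzag t (int k)" using z zigzag_eq_iff[OF t t] by simp
    moreover have "k \<in> {1..m_of t}"
      using r m_of(1)[OF t] by (auto simp: k_def)
    ultimately show "z \<in> (\<lambda>(t, k). zigzag t (int k)) ` (SIGMA t:T. {1..m_of t})"
      using t by (intro image_eqI[of _ _ "(t, k)"]) simp_all
  qed (use zigzags_eq in force)
qed

section \<open>Edges common to two zigzags\<close>

lemma zz_edges_disjoint:
  assumes "t \<in> T" "zigzag t l \<noteq> zigzag t l'"
  shows "zz_edges (zigzag t l) \<inter> zz_edges (zigzag t l') = {}"
proof -
  have "\<not> 2 * int (m_of t) dvd l - l'" "\<not> 2 * int (m_of t) dvd l - (1 - l')"
    using assms(2) zigzag_eq_iff[OF assms(1,1), of l l'] by (simp_all add: algebra_simps)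
  then have disj: "zz_darts t l \<inter> zz_darts t l' = {}" "zz_darts t l \<inter> zz_darts t (1 - l') = {}"
    using zz_darts_disjoint[OF assms(1)] by blast+
  have "edge_of a \<noteq> edge_of b" if "a \<in> zz_darts t l" "b \<in> zz_darts t l'" for a b
    using that disj rev_zz_darts[OF assms(1) that(2)] unfolding edge_of_eq_iff by blast
  then show ?thesis
    unfolding zz_edges_zigzag[OF assms(1)] by blast
qed

text \<open>Rotation by \<open>L\<close> turns the period \<open>(2s, 0)\<close> of \<open>t\<close>
  into the period \<open>(2s, - 2s)\<close> of \<open>L t\<close>, whose second coordinate is a
  multiple of \<open>2 * m_of (L t)\<close>.\<close>

lemma m_of_dvd_s_of:
  assumes "t \<in> T"
  shows "m_of (L t) dvd s_of t"
proof -
  have "E t (2 * int (s_of t)) 0 = t" using s_of(2)[OF assms] by simp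
  then have "L (E t (2 * int (s_of t)) 0) = L t" by simp
  then have "\<exists>k. E (L t) k (- (2 * int (s_of t))) = L t" by (auto simp: E_L)
  then have "2 * int (m_of (L t)) dvd 2 * int (s_of t)"
    using m_of(2)[OF L_in_T[OF assms]] by simp
  then show ?thesis by simp
qed

text \<open>\<open>L (E t k l)\<close> has second coordinate \<open>- k\<close>, so it lies in the
  row \<open>l'\<close> exactly when \<open>k\<close> is congruent to \<open>- l'\<close> modulo
  \<open>2 * m_of (L t)\<close>; here \<open>k\<close> runs through \<open>2 * s_of t\<close>
  consecutive integers.\<close>

lemma card_L_row_Int_row:
  assumes "t \<in> T"
  shows "card (L ` row t l \<inter> row (L t) l') = s_of t div m_of (L t)"
proof -
  obtain c where c: "s_of t = m_of (L t) * c" using m_of_dvd_s_of[OF assms] by (rule dvdE)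
  let ?q = "2 * int (m_of (L t))"
  have q: "?q > 0" using m_of(1)[OF L_in_T[OF assms]] by simp
  have row: "row t l = (\<lambda>k. E t k l) ` {0..<?q * int c}"
    using row_eq_image[OF assms, of l] c by (simp add: mult.assoc)
  have mem: "L (E t k l) \<in> row (L t) l' \<longleftrightarrow> ?q dvd k + l'" for k
  proof -
    have "L (E t k l) \<in> row (L t) l' \<longleftrightarrow> ?q dvd - k - l'"
      unfolding E_L mem_row_iff[OF L_in_T[OF assms] L_in_T[OF assms]] by simp
    also have "- k - l' = - (k + l')" by simp
    finally show ?thesis by (simp only: dvd_minus_iff)
  qed
  have "L ` row t l \<inter> row (L t) l' = (\<lambda>k. L (E t k l)) ` {k \<in> {0..<?q * int c}. ?q dvd k + l'}"
    unfolding row using mem by blast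
  moreover have "inj_on (\<lambda>k. L (E t k l)) {k \<in> {0..<?q * int c}. ?q dvd k + l'}"
    using inj_on_E[OF assms, of l] c by (auto simp: inj_on_def)
  ultimately have "card (L ` row t l \<inter> row (L t) l') = card {k \<in> {0..<?q * int c}. ?q dvd k + l'}"
    by (simp only: card_image)
  also have "\<dots> = c" using q by (rule card_residue_class)
  finally show ?thesis using c m_of(1)[OF L_in_T[OF assms]] by simp
qed

text \<open>The first zigzag has darts in the classes of \<open>L t\<close> and
  \<open>L (L t)\<close>, the second in those of \<open>L (L t)\<close> and \<open>t\<close>. They
  meet only in the class of \<open>L (L t)\<close>, where each edge is the second edge of a face for
  the first zigzag and the first one for the second. The row \<open>1 - l'\<close> covers the
  opposite orientation.\<close>

lemma zz_edges_Int:
  assumes t: "t \<in> T"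
  shows "zz_edges (zigzag t l) \<inter> zz_edges (zigzag (L t) l') =
    edge_of ` L ` (L ` row t l \<inter> (row (L t) l' \<union> row (L t) (1 - l')))"
proof -
  have t': "L t \<in> T" "L (L t) \<in> T" using t by simp_all
  have common: "\<exists>x\<in>L ` row t l \<inter> row (L t) j. a = L x"
    if a: "a \<in> zz_darts t l" "a \<in> zz_darts (L t) j" for a j
  proof -
    have row: "L y \<in> dart_class (L t)" "L (L y) \<in> dart_class (L (L t))" if "y \<in> row t l" for y
    proof -
      have "y \<in> dart_class t" using row_subset_class that by blast
      then show "L y \<in> dart_class (L t)" by (simp only: L_in_class[OF t])
      then show "L (L y) \<in> dart_class (L (L t))" by (simp only: L_in_class[OF t'(1)])
    qed
    have row': "L y \<in> dart_class (L (L t))" "L (L y) \<in> dart_class t" if "y \<in> row (L t) j" for y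
    proof -
      have "y \<in> dart_class (L t)" using row_subset_class that by blast
      then show "L y \<in> dart_class (L (L t))" by (simp only: L_in_class[OF t'(1)])
      then show "L (L y) \<in> dart_class t" using L_in_class[OF t'(2), of "L y"] LLL_T[OF t] by simp
    qed
    have "L t \<noteq> t" "L (L t) \<noteq> t" using T_distinct t by simp_all
    then have neq: "L y \<noteq> L z" "L y \<noteq> L (L z)" "L (L y) \<noteq> L (L z)" if "y \<in> row t l" "z \<in> row (L t) j" for y z
      using class_neq[OF t' _ row(1)[OF that(1)] row'(1)[OF that(2)]]
        class_neq[OF t'(1) t _ row(1)[OF that(1)] row'(2)[OF that(2)]]
        class_neq[OF t'(2) t _ row(2)[OF that(1)] row'(2)[OF that(2)]] by simp_all
    obtain y where y: "y \<in> row t l" "a = L y \<or> a = L (L y)"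
      using a(1) unfolding zz_darts_def by blast
    obtain z where z: "z \<in> row (L t) j" "a = L z \<or> a = L (L z)"
      using a(2) unfolding zz_darts_def by blast
    \<comment> \<open>The only combination in which both darts lie in the same class.\<close>
    have "a = L (L y)" "a = L z"
      using neq[OF y(1) z(1)] y(2) z(2) by argo+
    then have "z = L y" by simp
    then show ?thesis
      using y(1) z(1) \<open>a = L z\<close> by (intro bexI[of _ z]) simp_all
  qed
  show ?thesis unfolding zz_edges_zigzag[OF t] zz_edges_zigzag[OF t'(1)]
  proof (intro equalityI subsetI)
    fix e assume "e \<in> edge_of ` zz_darts t l \<inter> edge_of ` zz_darts (L t) l'"
    then obtain a b where a: "a \<in> zz_darts t l" "e = edge_of a" and b: "b \<in> zz_darts (L t) l'" "e = edge_of b"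
      by blast
    have "edge_of a = edge_of b" using a(2) b(2) by simp
    then have "a = b \<or> a = rev_dart b" unfolding edge_of_eq_iff .
    then have "a \<in> zz_darts (L t) l' \<or> a \<in> zz_darts (L t) (1 - l')"
      using b(1) rev_zz_darts[OF t'(1) b(1)] by blast
    then show "e \<in> edge_of ` L ` (L ` row t l \<inter> (row (L t) l' \<union> row (L t) (1 - l')))"
    proof
      assume "a \<in> zz_darts (L t) l'"
      from common[OF a(1) this] show ?thesis unfolding a(2) by blast
    next
      assume "a \<in> zz_darts (L t) (1 - l')"
      from common[OF a(1) this] show ?thesis unfolding a(2) by blast
    qed
  next
    fix e assume "e \<in> edge_of ` L ` (L ` row t l \<inter> (row (L t) l' \<union> row (L t) (1 - l')))"
    then obtain x where x: "e = edge_of (L x)" "x \<in> L ` row t l" "x \<in> row (L t) l' \<or> x \<in> row (L t) (1 - l')"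
      by blast
    have "L x \<in> zz_darts t l" using x(2) unfolding zz_darts_def by blast
    moreover have "e \<in> edge_of ` zz_darts (L t) l'"
      using x(3)
    proof
      assume "x \<in> row (L t) (1 - l')"
      then have "L x \<in> zz_darts (L t) (1 - l')" unfolding zz_darts_def by blast
      then have "rev_dart (L x) \<in> zz_darts (L t) l'"
        using rev_zz_darts[OF t'(1), of "L x" "1 - l'"] by simp
      moreover have "edge_of (rev_dart (L x)) = e" using x(1) by (simp add: edge_of_eq_iff)
      ultimately show ?thesis by blast
    next
      assume "x \<in> row (L t) l'"
      then have "L x \<in> zz_darts (L t) l'" unfolding zz_darts_def by blast
      then show ?thesis unfolding x(1) by (rule imageI)
    qed
    ultimately show "e \<in> edge_of ` zz_darts t l \<inter> edge_of ` zz_darts (L t) l'"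
      using x(1) by blast
  qed
qed

text \<open>The rows \<open>l'\<close> and \<open>1 - l'\<close> are disjoint and each contributes
  \<open>s_of t div m_of (L t)\<close> edges; \<open>n_eq\<close> then replaces
  \<open>s_of t\<close>. The product form avoids a division until exactness is known.\<close>

lemma card_zz_edges_Int_L:
  assumes t: "t \<in> T"
  shows "2 * m_of t * m_of (L t) * card (zz_edges (zigzag t l) \<inter> zz_edges (zigzag (L t) l')) = n"
proof -
  have t': "L t \<in> T" using t by simp
  let ?A = "\<lambda>j. L ` row t l \<inter> row (L t) j"
  let ?B = "L ` row t l \<inter> (row (L t) l' \<union> row (L t) (1 - l'))"
  have "inj_on edge_of (fst ` zz t l)"
    using simple_zz[OF t] by (rule inj_on_imageI)
  moreover have "L ` ?B \<subseteq> fst ` zz t l"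
    unfolding fst_zz zz_darts_def by blast
  ultimately have "inj_on edge_of (L ` ?B)"
    by (rule inj_on_subset)
  then have "card (edge_of ` L ` ?B) = card (L ` ?B)"
    by (rule card_image)
  also have "\<dots> = card ?B"
    by (rule card_image[OF inj_on_subset[OF bij_is_inj[OF bij_L] subset_UNIV]])
  finally have "card (zz_edges (zigzag t l) \<inter> zz_edges (zigzag (L t) l')) = card (?A l' \<union> ?A (1 - l'))"
    by (simp only: zz_edges_Int[OF t] Int_Un_distrib)
  also have "\<dots> = card (?A l') + card (?A (1 - l'))"
  proof (rule card_Un_disjoint)
    have "\<not> 2 * int (m_of (L t)) dvd l' - (1 - l')"
    proof
      assume "2 * int (m_of (L t)) dvd l' - (1 - l')"
      then have "2 dvd l' - (1 - l')" by (rule dvd_mult_left)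
      then show False by presburger
    qed
    then have "row (L t) l' \<inter> row (L t) (1 - l') = {}"
      using row_disjoint[OF t' t'] row_eq_iff[OF t' t'] by blast
    then show "?A l' \<inter> ?A (1 - l') = {}" by blast
  qed (simp_all add: finite_row[OF t])
  also have "\<dots> = 2 * (s_of t div m_of (L t))"
    by (simp add: card_L_row_Int_row[OF t])
  finally have "card (zz_edges (zigzag t l) \<inter> zz_edges (zigzag (L t) l')) = 2 * (s_of t div m_of (L t))" .
  moreover have "m_of (L t) * (s_of t div m_of (L t)) = s_of t"
    using m_of_dvd_s_of[OF t] by (rule dvd_mult_div_cancel)
  ultimately have "2 * m_of t * m_of (L t) * card (zz_edges (zigzag t l) \<inter> zz_edges (zigzag (L t) l')) = 4 * s_of t * m_of t"
    by algebra
  then show ?thesis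
    by (simp only: n_eq[OF t])
qed

lemma card_zz_edges_Int:
  assumes "t \<in> T" "t' \<in> T" "t \<noteq> t'"
  shows "2 * m_of t * m_of t' * card (zz_edges (zigzag t l) \<inter> zz_edges (zigzag t' l')) = n"
proof -
  have "t' \<in> {t, L t, L (L t)}" using T_eq[OF assms(1)] assms(2) by simp
  then have "t' = L t \<or> t = L t'" using assms(3) LLL_T[OF assms(1)] by auto
  then show ?thesis
  proof
    assume "t' = L t"
    then show ?thesis using card_zz_edges_Int_L[OF assms(1)] by simp
  next
    assume t: "t = L t'"
    have "2 * m_of t' * m_of t * card (zz_edges (zigzag t' l') \<inter> zz_edges (zigzag t l)) = n"
      using card_zz_edges_Int_L[OF assms(2)] unfolding t .
    then show ?thesis by (simp only: Int_commute ac_simps)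
  qed
qed

end


section \<open>Railroads along rows\<close>

context triangle_map
begin

section \<open>Faces met by a row\<close>

lemma E_eq_E_neg: "E t u v = E t (- k) (- l) \<longleftrightarrow> E t (u + k) (v + l) = t"
  by (subst E_eq_iff) simp

lemma face_E_neg: "t \<in> T \<Longrightarrow> face M (E t (- k) (- l)) = face M (E t k l)"
  using T_subset_D[of t] face_eq_iff[of "E t k l" "E t (- k) (- l)"]
  by (simp add: face_eq E_LLL)

text \<open>Around a face the three classes alternate, so of its darts only \<open>d\<close> and the
  opposite \<open>L^3 d\<close> lie in the class of \<open>d\<close>; in a triangle these
  coincide.\<close>

lemma face_E_eq_iff:
  assumes t: "t \<in> T"
  shows "face M (E t u v) = face M (E t k l) \<longleftrightarrow> E t u v = E t k l \<or> E t u v = E t (- k) (- l)"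
proof
  assume eq: "face M (E t u v) = face M (E t k l)"
  have D: "E t i j \<in> D" for i j using T_subset_D[OF t] by simp
  have cls: "L (E t i j) \<noteq> E t u v" "L (L (E t i j)) \<noteq> E t u v" for i j
  proof -
    have "L (E t i j) \<in> dart_class (L t)" by (simp add: E_L)
    moreover have "L (L (E t i j)) \<in> dart_class (L (L t))" by (simp add: E_L)
    ultimately show "L (E t i j) \<noteq> E t u v" "L (L (E t i j)) \<noteq> E t u v"
      using class_neq[OF L_in_T[OF t] t T_distinct(1)[OF t] _ E_in_class]
        class_neq[OF L_in_T[OF L_in_T[OF t]] t T_distinct(2)[OF t] _ E_in_class] by blast+
  qed
  have "E t u v \<in> face M (E t k l)"
    using eq[symmetric] unfolding face_eq_iff[OF D D] .
  then have "E t u v \<in> {E t k l, L (E t k l), L (L (E t k l)), E t (- k) (- l),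
      L (E t (- k) (- l)), L (L (E t (- k) (- l)))}"
    unfolding face_eq[OF D] E_LLL[OF t] .
  then show "E t u v = E t k l \<or> E t u v = E t (- k) (- l)"
    using cls[symmetric] by simp
next
  assume "E t u v = E t k l \<or> E t u v = E t (- k) (- l)"
  then show "face M (E t u v) = face M (E t k l)"
    using face_E_neg[OF t] by auto
qed

text \<open>A face is a triangle when its half-turn fixes its darts, that is, at half periods.
  Modulo the period lattice there are four of these, one for each triangle.\<close>

lemma hexagon_E_iff:
  assumes "t \<in> T"
  shows "face M (E t k l) \<in> hexagons M \<longleftrightarrow> E t (2 * k) (2 * l) \<noteq> t"
proof -
  have "face M (E t k l) \<in> hexagons M \<longleftrightarrow> E t k l \<noteq> E t (- k) (- l)"
    using hexagon_iff[of "E t k l"] T_subset_D[OF assms] E_LLL[OF assms] by (simp add: eq_commute)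
  then show ?thesis
    unfolding E_eq_E_neg by simp
qed

lemma row_hexagons_iff:
  assumes t: "t \<in> T"
  shows "(\<forall>b\<in>row t l. face M b \<in> hexagons M) \<longleftrightarrow> \<not> int (m_of t) dvd l"
proof
  assume hex: "\<forall>b\<in>row t l. face M b \<in> hexagons M"
  show "\<not> int (m_of t) dvd l"
  proof
    assume "int (m_of t) dvd l"
    then have "2 * int (m_of t) dvd 2 * l" by simp
    then have "\<exists>k. E t k (2 * l) = t" by (simp only: m_of(2)[OF t])
    then obtain k where k: "E t k (2 * l) = t" ..
    \<comment> \<open>The first coordinate of the period \<open>(k, 2 l)\<close> is even, so half of
      the period is a dart of the row \<open>l\<close>, and it lies on a triangle.\<close>
    then obtain j where "k = 2 * j" using E_even[OF t k] by (auto elim: evenE)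
    with k have "face M (E t j l) \<notin> hexagons M" by (simp add: hexagon_E_iff[OF t])
    with hex show False by simp
  qed
next
  assume "\<not> int (m_of t) dvd l"
  then have "E t k (2 * l) \<noteq> t" for k
    using m_of(2)[OF t, of "2 * l"] by auto
  then have "face M (E t k l) \<in> hexagons M" for k
    by (simp add: hexagon_E_iff[OF t])
  then show "\<forall>b\<in>row t l. face M b \<in> hexagons M"
    unfolding row_def by simp
qed

section \<open>Railroads and their number\<close>

lemma oriented_railroads_eq:
  "oriented_railroads M = (\<lambda>(t, l). row t l) ` {(t, l). t \<in> T \<and> \<not> int (m_of t) dvd l}"
proof (intro equalityI subsetI)
  fix R assume "R \<in> oriented_railroads M"
  then obtain a where a: "a \<in> D" "R = orbit S a" and hex: "\<forall>b\<in>R. face M b \<in> hexagons M"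
    unfolding oriented_railroads_def by blast
  obtain t k l where t: "t \<in> T" and "a = E t k l" using a(1) D_eq by auto
  then have "R = row t l" using orbit_S[OF t, of a l] a(2) by simp
  then show "R \<in> (\<lambda>(t, l). row t l) ` {(t, l). t \<in> T \<and> \<not> int (m_of t) dvd l}"
    using t hex row_hexagons_iff[OF t, of l] by (intro image_eqI[of _ _ "(t, l)"]) simp_all
next
  fix R assume "R \<in> (\<lambda>(t, l). row t l) ` {(t, l). t \<in> T \<and> \<not> int (m_of t) dvd l}"
  then obtain t l where t: "t \<in> T" and l: "\<not> int (m_of t) dvd l" and R: "R = row t l" by auto
  have "R = orbit S (E t 0 l)" using orbit_S[OF t, of "E t 0 l" l] R by simp
  moreover have "E t 0 l \<in> D" using T_subset_D[OF t] by simp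
  moreover have "\<forall>b\<in>R. face M b \<in> hexagons M" using row_hexagons_iff[OF t] l R by simp
  ultimately show "R \<in> oriented_railroads M"
    unfolding oriented_railroads_def by blast
qed

lemma LLL_row:
  assumes t: "t \<in> T"
  shows "(L ^^ 3) ` row t l = row t (- l)"
proof (intro equalityI subsetI)
  fix y assume "y \<in> (L ^^ 3) ` row t l"
  then obtain k where "y = L (L (L (E t k l)))" by (auto simp: row_def eval_nat_numeral)
  then show "y \<in> row t (- l)" by (simp add: E_LLL[OF t])
next
  fix y assume "y \<in> row t (- l)"
  then obtain k where k: "y = E t k (- l)" by (rule rowE)
  have "y = (L ^^ 3) (E t (- k) l)" using E_LLL[OF t, of "- k" l] k by (simp add: eval_nat_numeral)
  then show "y \<in> (L ^^ 3) ` row t l" by (rule image_eqI) simp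
qed

definition railroad :: "'a \<times> 'a \<Rightarrow> int \<Rightarrow> 'a railroad" where
  "railroad t l = {row t l, row t (- l)}"

lemma railroads_eq:
  "railroads M = (\<lambda>(t, l). railroad t l) ` {(t, l). t \<in> T \<and> \<not> int (m_of t) dvd l}"
  unfolding railroads_def oriented_railroads_eq image_image
  by (intro image_cong) (simp_all add: case_prod_beta railroad_def LLL_row)

lemma railroadE:
  assumes "r \<in> railroads M"
  obtains t l where "t \<in> T" "\<not> int (m_of t) dvd l" "r = railroad t l"
  using assms unfolding railroads_eq by auto

lemma railroad_in_railroads:
  "t \<in> T \<Longrightarrow> \<not> int (m_of t) dvd l \<Longrightarrow> railroad t l \<in> railroads M"
  unfolding railroads_eq by (intro image_eqI[of _ _ "(t, l)"]) simp_all

lemma railroad_eq_iff: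
  assumes "t \<in> T" "t' \<in> T"
  shows "railroad t l = railroad t' l' \<longleftrightarrow>
    t = t' \<and> (2 * int (m_of t) dvd l - l' \<or> 2 * int (m_of t) dvd l + l')"
proof -
  have "- l - - l' = - (l - l')" "l - - l' = l + l'" "- l - l' = - (l + l')"
    by simp_all
  then show ?thesis
    unfolding railroad_def doubleton_eq_iff row_eq_iff[OF assms]
    by (simp only: dvd_minus_iff) blast
qed

text \<open>Forgetting the direction identifies the residues \<open>l\<close> and \<open>- l\<close>
  modulo \<open>2 m\<close>. The two residues paired with themselves, 0 and \<open>m\<close>, are
  the rows through triangles; \<open>1, ..., m - 1\<close> represent the remaining pairs.\<close>

lemma bij_betw_railroad:
  "bij_betw (\<lambda>(t, k). railroad t (int k)) (SIGMA t:T. {1..<m_of t}) (railroads M)"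
proof (rule bij_betw_imageI)
  show "inj_on (\<lambda>(t, k). railroad t (int k)) (SIGMA t:T. {1..<m_of t})"
  proof (rule inj_onI)
    fix x x'
    assume "x \<in> (SIGMA t:T. {1..<m_of t})" "x' \<in> (SIGMA t:T. {1..<m_of t})"
      and eq: "(\<lambda>(t, k). railroad t (int k)) x = (\<lambda>(t, k). railroad t (int k)) x'"
    then obtain t k t' k' where x: "x = (t, k)" "x' = (t', k')"
      and t: "t \<in> T" "t' \<in> T" and k: "k \<in> {1..<m_of t}" "k' \<in> {1..<m_of t'}"
      by (elim SigmaE) simp
    have "railroad t (int k) = railroad t' (int k')" using eq x by simp
    then have "t = t' \<and> (2 * int (m_of t) dvd int k - int k' \<or> 2 * int (m_of t) dvd int k + int k')"
      unfolding railroad_eq_iff[OF t] .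
    then have tt: "t = t'"
      and *: "2 * int (m_of t) dvd int k - int k' \<or> 2 * int (m_of t) dvd int k + int k'"
      by blast+
    from * have "k = k'"
    proof
      assume "2 * int (m_of t) dvd int k - int k'"
      moreover have "\<bar>int k - int k'\<bar> < 2 * int (m_of t)" using k tt by auto
      ultimately show ?thesis
        using dvd_imp_le_int[of "int k - int k'" "2 * int (m_of t)"] by linarith
    next
      assume "2 * int (m_of t) dvd int k + int k'"
      moreover have "0 < int k + int k'" "int k + int k' < 2 * int (m_of t)" using k tt by auto
      ultimately show ?thesis
        using zdvd_not_zless[of "int k + int k'" "2 * int (m_of t)"] by simp
    qed
    with tt x show "x = x'" by simp
  qed
  show "(\<lambda>(t, k). railroad t (int k)) ` (SIGMA t:T. {1..<m_of t}) = railroads M"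
  proof (intro equalityI subsetI)
    fix r assume "r \<in> railroads M"
    then obtain t l where t: "t \<in> T" and l: "\<not> int (m_of t) dvd l" and r: "r = railroad t l"
      by (rule railroadE)
    define i where "i = l mod (2 * int (m_of t))"
    have i: "0 \<le> i" "i < 2 * int (m_of t)" using m_of(1)[OF t] by (simp_all add: i_def)
    have dvd: "2 * int (m_of t) dvd l - i" unfolding i_def by (rule dvd_minus_mod)
    have "int (m_of t) dvd l - i" using dvd by (rule dvd_mult_right)
    then have "\<not> int (m_of t) dvd i"
      using l dvd_add[of "int (m_of t)" "l - i" i] by auto
    then have "i \<noteq> 0" "i \<noteq> int (m_of t)" by auto
    define k where "k = (if i < int (m_of t) then nat i else nat (2 * int (m_of t) - i))"
    have "2 * int (m_of t) dvd l - int k \<or> 2 * int (m_of t) dvd l + int k"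
    proof (cases "i < int (m_of t)")
      case True
      then show ?thesis using dvd i by (simp add: k_def)
    next
      case False
      then have "l + int k = (l - i) + 2 * int (m_of t)" using i by (simp add: k_def)
      moreover have "2 * int (m_of t) dvd (l - i) + 2 * int (m_of t)"
        using dvd by (rule dvd_add) simp
      ultimately have "2 * int (m_of t) dvd l + int k" by (simp only:)
      then show ?thesis ..
    qed
    then have "r = railroad t (int k)" using r railroad_eq_iff[OF t t] by simp
    moreover have "k \<in> {1..<m_of t}"
      using i \<open>i \<noteq> 0\<close> \<open>i \<noteq> int (m_of t)\<close> by (auto simp: k_def)
    ultimately show "r \<in> (\<lambda>(t, k). railroad t (int k)) ` (SIGMA t:T. {1..<m_of t})"
      using t by (intro image_eqI[of _ _ "(t, k)"]) simp_all
  next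
    fix r assume "r \<in> (\<lambda>(t, k). railroad t (int k)) ` (SIGMA t:T. {1..<m_of t})"
    then obtain t k where t: "t \<in> T" and k: "k \<in> {1..<m_of t}" and r: "r = railroad t (int k)"
      by (elim imageE SigmaE) simp
    have "\<not> int (m_of t) dvd int k" using k zdvd_not_zless[of "int k" "int (m_of t)"] by simp
    with t r show "r \<in> railroads M" by (simp add: railroad_in_railroads)
  qed
qed

lemma finite_railroads: "finite (railroads M)"
  using bij_betw_finite[OF bij_betw_railroad] by simp

lemma card_railroads: "card (railroads M) = (\<Sum>t\<in>T. m_of t - 1)"
  using bij_betw_same_card[OF bij_betw_railroad] by simp

definition row_faces :: "'a \<times> 'a \<Rightarrow> int \<Rightarrow> ('a \<times> 'a) set set" where
  "row_faces t l = face M ` row t l"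

lemma row_faces_nonempty: "row_faces t l \<noteq> {}"
  by (simp add: row_faces_def row_def)

lemma row_faces_uminus:
  assumes "t \<in> T"
  shows "row_faces t (- l) = row_faces t l"
proof -
  have sub: "row_faces t (- l) \<subseteq> row_faces t l" for l
  proof
    fix F assume "F \<in> row_faces t (- l)"
    then obtain k where "F = face M (E t k (- l))" by (auto simp: row_faces_def row_def)
    then have "F = face M (E t (- k) l)" using face_E_neg[OF assms, of "- k" l] by simp
    then show "F \<in> row_faces t l" by (simp add: row_faces_def)
  qed
  from sub[of l] sub[of "- l"] show ?thesis by simp
qed

lemma railroad_faces_railroad: "t \<in> T \<Longrightarrow> railroad_faces M (railroad t l) = row_faces t l"
  using row_faces_uminus[of t l]
  by (simp add: railroad_faces_def railroad_def image_Un flip: row_faces_def)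

lemma row_faces_disjoint:
  assumes t: "t \<in> T" and "\<not> 2 * int (m_of t) dvd l - l'" "\<not> 2 * int (m_of t) dvd l + l'"
  shows "row_faces t l \<inter> row_faces t l' = {}"
proof -
  have "face M (E t k l) \<noteq> face M (E t k' l')" for k k'
  proof
    assume "face M (E t k l) = face M (E t k' l')"
    then have "E t k l \<in> row t l' \<or> E t k l \<in> row t (- l')"
      unfolding face_E_eq_iff[OF t] by auto
    then show False
      using assms(2,3) by (simp add: mem_row_iff[OF t t])
  qed
  then show ?thesis
    unfolding row_faces_def row_def by blast
qed

lemma row_faces_disjoint_nat:
  assumes t: "t \<in> T" and "j < k" "k < m_of t"
  shows "row_faces t (int k) \<inter> row_faces t (int j) = {}"
proof (rule row_faces_disjoint[OF t])
  show "\<not> 2 * int (m_of t) dvd int k - int j"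
    using assms zdvd_not_zless[of "int k - int j" "2 * int (m_of t)"] by simp
  show "\<not> 2 * int (m_of t) dvd int k + int j"
    using assms zdvd_not_zless[of "int k + int j" "2 * int (m_of t)"] by simp
qed

text \<open>A hexagon met twice would be entered through opposite edges. That yields a period with
  second coordinate \<open>2 j\<close>, which is impossible unless \<open>m\<close> divides
  \<open>j\<close>.\<close>

lemma simple_railroad_railroad:
  assumes t: "t \<in> T" and l: "\<not> int (m_of t) dvd l"
  shows "simple_railroad M (railroad t l)"
proof -
  have "inj_on (face M) (row t j)" if "\<not> int (m_of t) dvd j" for j
  proof (rule inj_onI)
    fix x y assume xy: "x \<in> row t j" "y \<in> row t j" and face: "face M x = face M y"
    obtain k where x: "x = E t k j" using xy(1) by (rule rowE)
    obtain k' where y: "y = E t k' j" using xy(2) by (rule rowE)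
    from face have "E t k j = E t k' j \<or> E t k j = E t (- k') (- j)"
      unfolding x y face_E_eq_iff[OF t] .
    moreover have "E t (k + k') (2 * j) \<noteq> t"
      using that m_of(2)[OF t, of "2 * j"] by auto
    ultimately show "x = y"
      unfolding x y E_eq_E_neg mult_2 by blast
  qed
  from this[of l] this[of "- l"] l show ?thesis
    by (simp add: simple_railroad_def railroad_def)
qed

section \<open>The zigzags on the two sides of a railroad\<close>

lemma zigzag_uminus: "t \<in> T \<Longrightarrow> zigzag t (- l) = zigzag t (l + 1)"
  by (simp add: zigzag_eq_iff)

text \<open>A single dart of the row already determines the zigzag up to direction.\<close>

lemma row_along_zigzag_iff:
  assumes "t \<in> T" "t' \<in> T"
  shows "(\<forall>a\<in>row t l. (L a, True) \<in> \<Union>(zigzag t' l')) \<longleftrightarrow> zigzag t' l' = zigzag t l"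
proof -
  have Union: "(L a, True) \<in> \<Union>(zigzag t' l') \<longleftrightarrow> a \<in> row t' l' \<or> a \<in> row t' (1 - l')" for a
    by (simp add: zigzag_def zz_True_iff)
  show ?thesis
  proof
    assume "\<forall>a\<in>row t l. (L a, True) \<in> \<Union>(zigzag t' l')"
    then have "E t 0 l \<in> row t' l' \<or> E t 0 l \<in> row t' (1 - l')"
      by (simp only: Union E_in_row)
    moreover have "l - (1 - l') = l + l' - 1" by simp
    ultimately have "t = t' \<and> (2 * int (m_of t) dvd l - l' \<or> 2 * int (m_of t) dvd l + l' - 1)"
      unfolding mem_row_iff[OF assms] by metis
    then have "zigzag t l = zigzag t' l'"
      unfolding zigzag_eq_iff[OF assms] .
    then show "zigzag t' l' = zigzag t l" ..
  next
    assume "zigzag t' l' = zigzag t l"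
    then show "\<forall>a\<in>row t l. (L a, True) \<in> \<Union>(zigzag t' l')"
      by (simp add: zigzag_def zz_True_iff)
  qed
qed

text \<open>The two orientations are the rows \<open>l\<close> and \<open>- l\<close>, and the
  zigzag of \<open>- l\<close> is that of \<open>l + 1\<close> by reversal.\<close>

lemma bounding_zigzags_railroad:
  assumes t: "t \<in> T"
  shows "bounding_zigzags M (railroad t l) = {zigzag t l, zigzag t (l + 1)}"
proof (intro equalityI subsetI)
  fix z assume "z \<in> bounding_zigzags M (railroad t l)"
  then obtain j where z: "z \<in> zigzags M" and j: "j = l \<or> j = - l" and along: "\<forall>a\<in>row t j. (L a, True) \<in> \<Union>z"
    unfolding bounding_zigzags_def railroad_def by blast
  obtain t' l' where t': "t' \<in> T" and z': "z = zigzag t' l'" using z zigzags_eq by auto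
  have "z = zigzag t j"
    using along unfolding z' row_along_zigzag_iff[OF t t'] .
  then show "z \<in> {zigzag t l, zigzag t (l + 1)}"
    using j zigzag_uminus[OF t] by auto
next
  have zigzag: "zigzag t j \<in> zigzags M" for j
    using t zigzags_eq by force
  have along: "\<forall>a\<in>row t j. (L a, True) \<in> \<Union>(zigzag t j)" for j
    by (simp only: row_along_zigzag_iff[OF t t])
  fix z assume "z \<in> {zigzag t l, zigzag t (l + 1)}"
  then have "z = zigzag t l \<or> z = zigzag t (- l)" using zigzag_uminus[OF t] by simp
  then show "z \<in> bounding_zigzags M (railroad t l)"
    using zigzag along[of l] along[of "- l"] unfolding bounding_zigzags_def railroad_def by auto
qed

text \<open>Conversely the zigzag \<open>l\<close> lies only between the roads \<open>l - 1\<close>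
  and \<open>l\<close>. This drives both the maximality and the uniqueness of concentric
  sequences.\<close>

lemma railroad_bounded_by:
  assumes t: "t \<in> T" and r: "r \<in> railroads M" and z: "zigzag t l \<in> bounding_zigzags M r"
  shows "\<exists>j\<in>{l, l - 1}. r = railroad t j \<and> \<not> int (m_of t) dvd j"
proof -
  obtain t' c where t': "t' \<in> T" and c: "\<not> int (m_of t') dvd c" and r': "r = railroad t' c"
    using r by (rule railroadE)
  let ?q = "2 * int (m_of t)"
  have "zigzag t l = zigzag t' c \<or> zigzag t l = zigzag t' (c + 1)"
    using z bounding_zigzags_railroad[OF t'] by (simp add: r')
  then have tt: "t = t'"
    and d: "?q dvd l - c \<or> ?q dvd l + c - 1 \<or> ?q dvd l - (c + 1) \<or> ?q dvd l + (c + 1) - 1"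
    unfolding zigzag_eq_iff[OF t t'] by blast+
  have "l + c - 1 = (l - 1) + c" "l - (c + 1) = (l - 1) - c" "l + (c + 1) - 1 = l + c"
    by simp_all
  with d have "?q dvd l - c \<or> ?q dvd (l - 1) + c \<or> ?q dvd (l - 1) - c \<or> ?q dvd l + c"
    by (simp only:)
  then obtain j where j: "j \<in> {l, l - 1}" and dvd: "?q dvd j - c \<or> ?q dvd j + c" by blast
  have "r = railroad t j"
  proof -
    have "?q dvd c - j \<or> ?q dvd c + j"
      using dvd by (simp only: dvd_diff_commute add.commute)
    then show ?thesis
      unfolding r' tt[symmetric] railroad_eq_iff[OF t t] by simp
  qed
  moreover have "\<not> int (m_of t) dvd j"
  proof
    assume "int (m_of t) dvd j"
    from dvd have "int (m_of t) dvd c"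
    proof
      assume "?q dvd j - c"
      then have "int (m_of t) dvd j - c" by (rule dvd_mult_right)
      from dvd_diff[OF \<open>int (m_of t) dvd j\<close> this] show ?thesis by simp
    next
      assume "?q dvd j + c"
      then have "int (m_of t) dvd j + c" by (rule dvd_mult_right)
      from dvd_diff[OF this \<open>int (m_of t) dvd j\<close>] show ?thesis by simp
    qed
    with c tt show False by simp
  qed
  ultimately show ?thesis using j by blast
qed

section \<open>The patch of row 0 and its boundary\<close>

lemma face_in_row_faces_0_iff:
  assumes t: "t \<in> T" and a: "a \<in> D"
  shows "face M a \<in> row_faces t 0 \<longleftrightarrow> a \<in> row t 0 \<or> a \<in> zz_darts t 0"
proof -
  have D: "y \<in> D" if "y \<in> row t 0" for y using row_subset_D[OF t] that by blast
  \<comment> \<open>The row 0 is mapped to itself by the half-turns of its faces, so the second half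
    of each face brings no further darts.\<close>
  have L3: "L (L (L y)) \<in> row t 0" if y: "y \<in> row t 0" for y
  proof -
    obtain k where "y = E t k 0" using y by (rule rowE)
    then have "L (L (L y)) = E t (- k) 0" using E_LLL[OF t, of k 0] by simp
    then show ?thesis by simp
  qed
  show ?thesis
  proof
    assume "face M a \<in> row_faces t 0"
    then obtain y where y: "y \<in> row t 0" "face M y = face M a" unfolding row_faces_def by auto
    then have "a \<in> face M y" using face_eq_iff[OF D a] by simp
    then have "a \<in> {y, L y, L (L y), L (L (L y)), L (L (L (L y))), L (L (L (L (L y))))}"
      by (simp only: face_eq[OF D[OF y(1)]])
    then show "a \<in> row t 0 \<or> a \<in> zz_darts t 0"
      using y(1) L3[OF y(1)] unfolding zz_darts_def by blast
  next
    assume "a \<in> row t 0 \<or> a \<in> zz_darts t 0"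
    then obtain y where y: "y \<in> row t 0" "a = y \<or> a = L y \<or> a = L (L y)"
      unfolding zz_darts_def by blast
    then have "a \<in> face M y" using face_eq[OF D[OF y(1)]] by auto
    then have "face M a = face M y" using face_eq_iff[OF D[OF y(1)] a] by simp
    then show "face M a \<in> row_faces t 0" using y(1) unfolding row_faces_def by simp
  qed
qed

lemma zz_darts_row_disjoint:
  assumes t: "t \<in> T"
  shows "zz_darts t l \<inter> row t l' = {}"
proof -
  have "a \<notin> dart_class t" if a: "a \<in> zz_darts t l" for a
  proof -
    obtain y where "y \<in> row t l" and y: "a = L y \<or> a = L (L y)"
      using a unfolding zz_darts_def by blast
    then have "y \<in> dart_class t" using row_subset_class by blast
    then have Ly: "L y \<in> dart_class (L t)" by (simp only: L_in_class[OF t])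
    then have "L (L y) \<in> dart_class (L (L t))" by (simp only: L_in_class[OF L_in_T[OF t]])
    then have "L (L y) \<notin> dart_class t"
      using class_disjoint[OF L_in_T[OF L_in_T[OF t]] t] T_distinct(2)[OF t] by blast
    moreover have "L y \<notin> dart_class t"
      using class_disjoint[OF L_in_T[OF t] t Ly] T_distinct(1)[OF t] by blast
    ultimately show ?thesis using y by metis
  qed
  then show ?thesis using row_subset_class by blast
qed

lemma zz_darts_subset_D:
  assumes "t \<in> T"
  shows "zz_darts t l \<subseteq> D"
  using row_subset_D[OF assms, of l] unfolding zz_darts_def by auto

text \<open>Reversal preserves the row 0, so its edges are interior to the patch; the side edges
  reverse to darts of the zigzag 1, whose faces lie outside.\<close>

lemma boundary_edges_row_faces_0:
  assumes t: "t \<in> T"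
  shows "boundary_edges M (row_faces t 0) = zz_edges (zigzag t 0)"
proof -
  have "{a \<in> D. face M a \<in> row_faces t 0 \<and> face M (rev_dart a) \<notin> row_faces t 0} = zz_darts t 0"
  proof (intro equalityI subsetI)
    fix a assume "a \<in> {a \<in> D. face M a \<in> row_faces t 0 \<and> face M (rev_dart a) \<notin> row_faces t 0}"
    then have a: "a \<in> D" "face M a \<in> row_faces t 0" "face M (rev_dart a) \<notin> row_faces t 0" by auto
    have "a \<notin> row t 0"
    proof
      assume "a \<in> row t 0"
      then obtain k where "a = E t k 0" by (rule rowE)
      then have "rev_dart a = E t (1 - k) 0" using E_rev[OF t, of k 0] by simp
      then have "face M (rev_dart a) \<in> row_faces t 0" unfolding row_faces_def by simp
      with a(3) show False by simp
    qed
    then show "a \<in> zz_darts t 0" using a(2) face_in_row_faces_0_iff[OF t a(1)] by simp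
  next
    fix a assume a: "a \<in> zz_darts t 0"
    then have D: "a \<in> D" using zz_darts_subset_D[OF t] by blast
    have "rev_dart a \<in> zz_darts t 1" using rev_zz_darts[OF t a] by simp
    then have "rev_dart a \<notin> zz_darts t 0" "rev_dart a \<notin> row t 0"
      using zz_darts_rev_disjoint[OF t, of 1] zz_darts_row_disjoint[OF t, of 1] by auto
    then show "a \<in> {a \<in> D. face M a \<in> row_faces t 0 \<and> face M (rev_dart a) \<notin> row_faces t 0}"
      using a D face_in_row_faces_0_iff[OF t D] face_in_row_faces_0_iff[OF t, of "rev_dart a"] by simp
  qed
  then show ?thesis
    by (simp add: boundary_edges_def zz_edges_zigzag[OF t])
qed

lemma zigzag_0: "t \<in> T \<Longrightarrow> zigzag t 0 = zigzag t 1"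
  by (simp add: zigzag_eq_iff)

lemma card_zz_edges:
  assumes "t \<in> T"
  shows "card (zz_edges (zigzag t l)) = 4 * s_of t"
proof -
  have "inj_on edge_of (fst ` zz t l)"
    using simple_zz[OF assms] by (rule inj_on_imageI)
  then show ?thesis
    using card_zz_darts[OF assms] by (simp add: zz_edges_zigzag[OF assms] fst_zz card_image)
qed

text \<open>\<open>concentric_zigzags\<close> specifies its first zigzag only by its edges. Within a
  class, distinct zigzags are edge-disjoint; across classes, sharing all \<open>4 s\<close> edges
  would give \<open>2 m m' * 4 s = n = 4 s m\<close>.\<close>

lemma zigzag_eq_if_zz_edges_eq:
  assumes t: "t \<in> T" and t': "t' \<in> T" and eq: "zz_edges (zigzag t l) = zz_edges (zigzag t' l')"
  shows "zigzag t l = zigzag t' l'"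
proof (rule ccontr)
  assume neq: "zigzag t l \<noteq> zigzag t' l'"
  have card: "card (zz_edges (zigzag t l) \<inter> zz_edges (zigzag t' l')) = 4 * s_of t"
    using card_zz_edges[OF t, of l] eq by simp
  show False
  proof (cases "t = t'")
    case True
    then show False
      using zz_edges_disjoint[OF t, of l l'] neq card s_of(1)[OF t] by simp
  next
    case False
    have "2 * m_of t * m_of t' * (4 * s_of t) = 4 * s_of t * m_of t"
      using card_zz_edges_Int[OF t t' False, of l l'] unfolding card n_eq[OF t] .
    then show False
      using s_of(1)[OF t] m_of(1)[OF t] m_of(1)[OF t'] by simp
  qed
qed

end


section \<open>The parameters\<close>

lemma image_mset_mset_set_const:
  assumes "\<And>x. x \<in> A \<Longrightarrow> f x = c"
  shows "image_mset f (mset_set A) = replicate_mset (card A) c"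
proof (cases "finite A")
  case True
  then have "image_mset f (mset_set A) = image_mset (\<lambda>_. c) (mset_set A)"
    using assms by (intro image_mset_cong) simp
  then show ?thesis by (simp add: image_mset_const_eq)
qed simp

text \<open>Provides a labelling of the darts of \<open>T\<close> with increasing
  \<open>s\<close>.\<close>

lemma ex_sorted_triple:
  fixes f :: "'a \<Rightarrow> 'b::linorder"
  assumes "card A = 3"
  shows "\<exists>a b c. A = {a, b, c} \<and> a \<noteq> b \<and> a \<noteq> c \<and> b \<noteq> c \<and> f a \<le> f b \<and> f b \<le> f c"
proof -
  have "finite A" using assms by (metis card.infinite zero_neq_numeral)
  then obtain xs where xs: "set xs = A" "distinct xs" using finite_distinct_list by blast
  define ys where "ys = sort_key f xs"
  have ys: "set ys = A" "distinct ys" "sorted (map f ys)" using xs by (simp_all add: ys_def)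
  then have "length ys = 3" using distinct_card[of ys] assms by simp
  then obtain a b c where "ys = [a, b, c]" by (auto simp: length_Suc_conv numeral_3_eq_3)
  then have "A = {a, b, c}" "a \<noteq> b \<and> a \<noteq> c \<and> b \<noteq> c \<and> f a \<le> f b \<and> f b \<le> f c"
    using ys by simp_all
  then show ?thesis by (intro exI[of _ a] exI[of _ b] exI[of _ c]) simp
qed

context triangle_map
begin

section \<open>Concentric zigzags around the patch\<close>

lemma zigzag_in_zigzags: "t \<in> T \<Longrightarrow> zigzag t l \<in> zigzags M"
  unfolding zigzags_eq by (intro image_eqI[of _ _ "(t, l)"]) simp_all

text \<open>The railroads are the rows \<open>1, ..., m - 1\<close>. The sequence is maximal because
  beyond the zigzag \<open>m\<close> lies the row \<open>m\<close>, which contains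
  triangles.\<close>

lemma concentric_zigzags_row_faces:
  assumes t: "t \<in> T"
  shows "concentric_zigzags M (row_faces t 0) (m_of t) (\<lambda>k. zigzag t (int k))"
proof -
  let ?m = "m_of t"
  have not_dvd: "\<not> int ?m dvd int k" if "0 < k" "k < ?m" for k
    using that zdvd_not_zless[of "int k" "int ?m"] by simp
  have disj: "row_faces t (int k) \<inter> (row_faces t 0 \<union> (\<Union>j\<in>{1..<k}. railroad_faces M (railroad t (int j)))) = {}"
    if "0 < k" "k < ?m" for k
  proof -
    have "row_faces t (int k) \<inter> row_faces t (int j) = {}" if "j < k" for j
      using row_faces_disjoint_nat[OF t that \<open>k < ?m\<close>] .
    from this[of 0] this show ?thesis
      using \<open>0 < k\<close> by (simp add: railroad_faces_railroad[OF t] Int_Un_distrib Int_UN_distrib)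
  qed
  have rail: "railroad t (int k) \<in> railroads M \<and> simple_railroad M (railroad t (int k)) \<and>
      railroad_faces M (railroad t (int k)) \<inter>
        (row_faces t 0 \<union> (\<Union>j\<in>{1..<k}. railroad_faces M (railroad t (int j)))) = {} \<and>
      bounding_zigzags M (railroad t (int k)) = {zigzag t (int k), zigzag t (int (Suc k))}"
    if "k \<in> {1..<?m}" for k
    using that not_dvd[of k] disj[of k] railroad_in_railroads[OF t] simple_railroad_railroad[OF t]
      bounding_zigzags_railroad[OF t, of "int k"]
    by (simp add: railroad_faces_railroad[OF t] add.commute)
  have maximal: "\<not> (\<exists>r\<in>railroads M. \<exists>z. simple_railroad M r \<and>
      railroad_faces M r \<inter> (row_faces t 0 \<union> (\<Union>j\<in>{1..<?m}. railroad_faces M (railroad t (int j)))) = {} \<and>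
      bounding_zigzags M r = {zigzag t (int ?m), z})"
  proof
    assume "\<exists>r\<in>railroads M. \<exists>z. simple_railroad M r \<and>
      railroad_faces M r \<inter> (row_faces t 0 \<union> (\<Union>j\<in>{1..<?m}. railroad_faces M (railroad t (int j)))) = {} \<and>
      bounding_zigzags M r = {zigzag t (int ?m), z}"
    then obtain r z where r: "r \<in> railroads M" "bounding_zigzags M r = {zigzag t (int ?m), z}"
      and r_disj: "railroad_faces M r \<inter> (row_faces t 0 \<union> (\<Union>j\<in>{1..<?m}. railroad_faces M (railroad t (int j)))) = {}"
      by blast
    have "zigzag t (int ?m) \<in> bounding_zigzags M r" unfolding r(2) by simp
    from railroad_bounded_by[OF t r(1) this]
    obtain j where j: "j \<in> {int ?m, int ?m - 1}" "r = railroad t j" "\<not> int ?m dvd j"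
      by blast
    \<comment> \<open>The choice \<open>j = m\<close> is ruled out by divisibility, and so is
      \<open>j = 0\<close> in case \<open>m = 1\<close>; hence \<open>r\<close> is the last railroad
      already used.\<close>
    then have j_eq: "j = int (?m - 1)" using m_of(1)[OF t] by (auto simp: of_nat_diff)
    with j(3) have "?m - 1 \<in> {1..<?m}" by (cases "?m - 1 = 0") auto
    then have "railroad_faces M r \<subseteq> (\<Union>j\<in>{1..<?m}. railroad_faces M (railroad t (int j)))"
      unfolding j(2) j_eq by blast
    moreover have "railroad_faces M r \<noteq> {}"
      unfolding j(2) railroad_faces_railroad[OF t] by (rule row_faces_nonempty)
    ultimately show False using r_disj by blast
  qed
  show ?thesis
    unfolding concentric_zigzags_def
  proof (intro conjI)
    show "1 \<le> ?m" using m_of(1)[OF t] by simp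
    show "zigzag t (int 1) \<in> zigzags M" by (rule zigzag_in_zigzags[OF t])
    show "zz_edges (zigzag t (int 1)) = boundary_edges M (row_faces t 0)"
      by (simp add: boundary_edges_row_faces_0[OF t] zigzag_0[OF t])
  qed (rule exI[of _ "\<lambda>k. railroad t (int k)"], rule conjI, rule ballI, erule rail, rule maximal)
qed

text \<open>At each zigzag the only way to continue is outward, since the road on the inner side is
  already used; the sequence can stop only when it reaches the row \<open>m_of t\<close>.\<close>

lemma concentric_zigzags_row_faces_unique:
  assumes t: "t \<in> T" and conc: "concentric_zigzags M (row_faces t 0) m Z"
  shows "m = m_of t" "\<And>k. k \<in> {1..m} \<Longrightarrow> Z k = zigzag t (int k)"
proof -
  let ?U = "\<lambda>R m. row_faces t 0 \<union> (\<Union>j\<in>{1..<m}. railroad_faces M (R j))"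
  note conc' = conc[unfolded concentric_zigzags_def]
  note m = conjunct1[OF conc'] and Z1 = conjunct2[OF conc', THEN conjunct1]
    conjunct2[OF conc', THEN conjunct2, THEN conjunct1]
  from conjunct2[OF conc', THEN conjunct2, THEN conjunct2]
  obtain R where R_all: "\<forall>k\<in>{1..<m}. R k \<in> railroads M \<and> simple_railroad M (R k) \<and>
        railroad_faces M (R k) \<inter> ?U R k = {} \<and> bounding_zigzags M (R k) = {Z k, Z (Suc k)}"
    and no_more: "\<not> (\<exists>r\<in>railroads M. \<exists>z. simple_railroad M r \<and>
        railroad_faces M r \<inter> ?U R m = {} \<and> bounding_zigzags M r = {Z m, z})"
    by (elim exE conjE) (rule that)
  note R = bspec[OF R_all]
  have maximal: False if "r \<in> railroads M" "simple_railroad M r"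
      "railroad_faces M r \<inter> ?U R m = {}" "bounding_zigzags M r = {Z m, z}" for r z
  proof -
    from that have "\<exists>r\<in>railroads M. \<exists>z. simple_railroad M r \<and>
        railroad_faces M r \<inter> ?U R m = {} \<and> bounding_zigzags M r = {Z m, z}"
      by (intro bexI[of _ r] exI[of _ z] conjI)
    with no_more show False by (rule notE)
  qed
  have first: "Z 1 = zigzag t (int 1)"
  proof -
    obtain t' l' where t': "t' \<in> T" and Z': "Z 1 = zigzag t' l'" using Z1(1) zigzags_eq by auto
    have "zz_edges (zigzag t' l') = zz_edges (zigzag t (int 1))"
      using Z1(2) boundary_edges_row_faces_0[OF t] zigzag_0[OF t] Z' by simp
    then show ?thesis unfolding Z' by (rule zigzag_eq_if_zz_edges_eq[OF t' t])
  qed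
  \<comment> \<open>The earlier railroads are identified along with \<open>Z k\<close>, in order to
    recognise a step back as a repetition.\<close>
  have step: "Z k = zigzag t (int k) \<and> (\<forall>j\<in>{1..<k}. R j = railroad t (int j) \<and> \<not> int (m_of t) dvd int j)"
    if "1 \<le> k" "k \<le> m" for k
    using that
  proof (induct k rule: nat_induct_at_least)
    case base
    then show ?case using first by simp
  next
    case (Suc k)
    then have k: "k \<in> {1..<m}" by simp
    have IH: "Z k = zigzag t (int k)" "\<And>j. j \<in> {1..<k} \<Longrightarrow> R j = railroad t (int j)"
      "\<And>j. j \<in> {1..<k} \<Longrightarrow> \<not> int (m_of t) dvd int j"
      using Suc by simp_all
    have bound: "bounding_zigzags M (R k) = {zigzag t (int k), Z (Suc k)}"
      using R[OF k] IH(1) by simp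
    have "R k \<in> railroads M" using R[OF k] by blast
    moreover have "zigzag t (int k) \<in> bounding_zigzags M (R k)" unfolding bound by simp
    ultimately have "\<exists>j\<in>{int k, int k - 1}. R k = railroad t j \<and> \<not> int (m_of t) dvd j"
      by (rule railroad_bounded_by[OF t])
    then obtain j where j: "j \<in> {int k, int k - 1}" "R k = railroad t j" "\<not> int (m_of t) dvd j"
      by blast
    \<comment> \<open>Stepping back would reuse the faces of \<open>R (k - 1)\<close>, or for
      \<open>k = 1\<close> those of the row 0, which is not a railroad.\<close>
    have "j \<noteq> int k - 1"
    proof
      assume "j = int k - 1"
      then have jk: "j = int (k - 1)" using Suc(1) by (simp add: of_nat_diff)
      with j(3) have "k - 1 \<in> {1..<k}" by (cases "k - 1 = 0") auto
      then have "railroad_faces M (R k) = railroad_faces M (R (k - 1))" using IH(2) j(2) jk by simp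
      then have "railroad_faces M (R k) \<subseteq> (\<Union>j\<in>{1..<k}. railroad_faces M (R j))"
        using \<open>k - 1 \<in> {1..<k}\<close> by blast
      moreover have "railroad_faces M (R k) \<noteq> {}"
        unfolding j(2) railroad_faces_railroad[OF t] by (rule row_faces_nonempty)
      moreover have "railroad_faces M (R k) \<inter> ?U R k = {}"
        by (rule R[OF k, THEN conjunct2, THEN conjunct2, THEN conjunct1])
      ultimately show False by blast
    qed
    with j(1) have jk: "j = int k" by simp
    have "{zigzag t (int k), Z (Suc k)} = {zigzag t (int k), zigzag t (int k + 1)}"
      using bound bounding_zigzags_railroad[OF t, of "int k"] j(2) jk by simp
    then have "Z (Suc k) = zigzag t (int k + 1)" unfolding doubleton_eq_iff by metis
    then have "Z (Suc k) = zigzag t (int (Suc k))" by (simp add: add.commute)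
    moreover have "R i = railroad t (int i) \<and> \<not> int (m_of t) dvd int i" if "i \<in> {1..<Suc k}" for i
    proof (cases "i = k")
      case True
      then show ?thesis using j jk by simp
    next
      case False
      with that have "i \<in> {1..<k}" by auto
      then show ?thesis using IH(2,3) by simp
    qed
    ultimately show ?case by simp
  qed
  show Z: "Z k = zigzag t (int k)" if "k \<in> {1..m}" for k
    using step[of k] that by simp
  have Rm: "R j = railroad t (int j)" "\<not> int (m_of t) dvd int j" if "j \<in> {1..<m}" for j
    using bspec[OF conjunct2[OF step[OF m order_refl]] that] by (rule conjunct1, rule conjunct2)
  \<comment> \<open>Otherwise the row \<open>m_of t\<close> would be one of the railroads although
    it contains triangles.\<close>
  have "m \<le> m_of t"
  proof (rule ccontr)
    assume "\<not> m \<le> m_of t"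
    then have "m_of t \<in> {1..<m}" using m_of(1)[OF t] by simp
    from Rm(2)[OF this] show False by simp
  qed
  \<comment> \<open>Otherwise the row \<open>m\<close> is a railroad that extends the
    sequence.\<close>
  moreover have "\<not> m < m_of t"
  proof
    assume "m < m_of t"
    then have nd: "\<not> int (m_of t) dvd int m"
      using m zdvd_not_zless[of "int m" "int (m_of t)"] by simp
    show False
    proof (rule maximal)
      show "railroad t (int m) \<in> railroads M" by (rule railroad_in_railroads[OF t nd])
      show "simple_railroad M (railroad t (int m))" by (rule simple_railroad_railroad[OF t nd])
      show "bounding_zigzags M (railroad t (int m)) = {Z m, zigzag t (int m + 1)}"
        using bounding_zigzags_railroad[OF t, of "int m"] Z[of m] m by simp
      have disj: "row_faces t (int m) \<inter> row_faces t (int j) = {}" if "j < m" for j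
        using row_faces_disjoint_nat[OF t that \<open>m < m_of t\<close>] .
      have "row_faces t (int m) \<inter> railroad_faces M (R j) = {}" if j: "j \<in> {1..<m}" for j
        unfolding Rm(1)[OF j] railroad_faces_railroad[OF t] using j by (intro disj) simp
      moreover have "row_faces t (int m) \<inter> row_faces t 0 = {}"
        using disj[of 0] m by simp
      ultimately show "railroad_faces M (railroad t (int m)) \<inter> ?U R m = {}"
        unfolding railroad_faces_railroad[OF t] by blast
    qed
  qed
  ultimately show "m = m_of t" by simp
qed

section \<open>The pseudo-road from a triangle\<close>

lemma hexagon_row_0_iff:
  assumes "t \<in> T"
  shows "face M (E t k 0) \<in> hexagons M \<longleftrightarrow> \<not> int (s_of t) dvd k"
  using hexagon_E_iff[OF assms, of k 0] s_of(2)[OF assms, of "2 * k"] by simp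

lemma rev_T: "t \<in> T \<Longrightarrow> rev_dart t = E t 1 0"
  using E_rev[of t 0 0] by simp

text \<open>The part of row 0 from \<open>rev_dart t\<close>, which has coordinate 1, to coordinate
  \<open>s\<close>, where the next triangle lies.\<close>

definition road :: "'a \<times> 'a \<Rightarrow> ('a \<times> 'a) list" where
  "road t = map (\<lambda>j. E t (int j + 1) 0) [0..<s_of t]"

lemma road_nonempty: "t \<in> T \<Longrightarrow> road t \<noteq> []"
  using s_of(1)[of t] by (simp add: road_def)

lemma hd_road: "t \<in> T \<Longrightarrow> hd (road t) = rev_dart t"
  using s_of(1)[of t] by (simp add: road_def hd_map rev_T)

lemma pseudo_road_road:
  assumes t: "t \<in> T"
  shows "pseudo_road M (road t)"
  unfolding pseudo_road_def
proof (intro conjI)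
  have s: "s_of t > 0" by (rule s_of(1)[OF t])
  show "road t \<noteq> []" by (rule road_nonempty[OF t])
  show "set (road t) \<subseteq> D" using T_subset_D[OF t] by (auto simp: road_def)
  have "face M (E t 0 0) \<notin> hexagons M" unfolding hexagon_row_0_iff[OF t] by simp
  then show "face M (rev_dart (hd (road t))) \<notin> hexagons M" by (simp add: hd_road[OF t])
  have "face M (E t (int j + 1) 0) \<in> hexagons M" if "j < s_of t - 1" for j
    unfolding hexagon_row_0_iff[OF t]
    using that zdvd_not_zless[of "int j + 1" "int (s_of t)"] by simp
  then show "\<forall>x\<in>set (butlast (road t)). face M x \<in> hexagons M"
    using s by (auto simp: road_def butlast_conv_take take_map)
  have "last (road t) = E t (int (s_of t)) 0"
    using s by (simp add: road_def last_map of_nat_diff)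
  then show "face M (last (road t)) \<notin> hexagons M"
    by (simp add: hexagon_row_0_iff[OF t])
  show "\<forall>j. Suc j < length (road t) \<longrightarrow> road t ! Suc j = S (road t ! j)"
    by (simp add: road_def E_S add.commute)
qed

text \<open>Going straight on is deterministic, so only the length is open. Ending outside the
  hexagons makes it a multiple of \<open>s\<close>; passing coordinate \<open>s\<close> would put a
  triangle in the interior.\<close>

lemma pseudo_road_unique:
  assumes t: "t \<in> T" and pr: "pseudo_road M xs" and hd: "hd xs = rev_dart t"
  shows "xs = road t"
proof -
  have xs: "xs \<noteq> []" "\<And>x. x \<in> set (butlast xs) \<Longrightarrow> face M x \<in> hexagons M"
    "face M (last xs) \<notin> hexagons M" "\<And>j. Suc j < length xs \<Longrightarrow> xs ! Suc j = S (xs ! j)"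
    using pr unfolding pseudo_road_def by blast+
  have nth: "xs ! j = E t (int j + 1) 0" if "j < length xs" for j
    using that
  proof (induct j)
    case 0
    then show ?case using hd xs(1) rev_T[OF t] by (simp add: hd_conv_nth)
  next
    case (Suc j)
    then show ?case using xs(4)[of j] by (simp add: E_S add.commute)
  qed
  have "int (length xs - 1) + 1 = int (length xs)"
    using xs(1) by (cases xs) simp_all
  then have "last xs = E t (int (length xs)) 0"
    using xs(1) nth[of "length xs - 1"] by (simp add: last_conv_nth)
  then have dvd: "s_of t dvd length xs"
    using xs(3) hexagon_row_0_iff[OF t] by simp
  then have le: "s_of t \<le> length xs" using xs(1) by (intro dvd_imp_le) auto
  have "\<not> s_of t < length xs"
  proof
    assume less: "s_of t < length xs"
    define j where "j = s_of t - 1"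
    have j: "j < length (butlast xs)" "int j + 1 = int (s_of t)"
      using less s_of(1)[OF t] by (simp_all add: j_def of_nat_diff)
    have "face M (butlast xs ! j) \<in> hexagons M"
      using xs(2) nth_mem[OF j(1)] by blast
    then have "face M (E t (int (s_of t)) 0) \<in> hexagons M"
      using j nth[of j] by (simp add: nth_butlast)
    then show False by (simp add: hexagon_row_0_iff[OF t])
  qed
  with le have "length xs = s_of t" by simp
  then show ?thesis
    using nth by (intro nth_equalityI) (simp_all add: road_def)
qed

text \<open>Coordinates from 0 to \<open>s\<close> already give all faces of the row: the other half
  of the cycle of length \<open>2 s\<close> enters the same faces through the opposite
  edges.\<close>

lemma road_patch:
  assumes t: "t \<in> T"
  shows "insert T (face M ` set (road t)) = row_faces t 0"
proof
  have "T = face M (E t 0 0)" using T_eq_face[OF t] by simp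
  then have "T \<in> row_faces t 0" unfolding row_faces_def by (rule image_eqI) (rule E_in_row)
  then show "insert T (face M ` set (road t)) \<subseteq> row_faces t 0"
    by (auto simp: row_faces_def road_def)
  have s: "s_of t > 0" by (rule s_of(1)[OF t])
  have road: "face M (E t i 0) \<in> insert T (face M ` set (road t))" if i: "0 \<le> i" "i \<le> int (s_of t)" for i
  proof (cases "i = 0")
    case True
    then show ?thesis using T_eq_face[OF t] by simp
  next
    case False
    then have "E t i 0 = E t (int (nat (i - 1)) + 1) 0" "nat (i - 1) < s_of t" using i by simp_all
    then have "E t i 0 \<in> set (road t)"
      unfolding road_def set_map by (intro image_eqI[of _ _ "nat (i - 1)"]) simp_all
    then show ?thesis by blast
  qed
  show "row_faces t 0 \<subseteq> insert T (face M ` set (road t))"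
  proof
    fix F assume "F \<in> row_faces t 0"
    then obtain k where F: "F = face M (E t k 0)" by (auto simp: row_faces_def row_def)
    define i where "i = k mod (2 * int (s_of t))"
    have i: "0 \<le> i" "i < 2 * int (s_of t)" using s by (simp_all add: i_def)
    have dvd: "2 * int (s_of t) dvd k - i" unfolding i_def by (rule dvd_minus_mod)
    show "F \<in> insert T (face M ` set (road t))"
    proof (cases "i \<le> int (s_of t)")
      case True
      have "E t k 0 = E t i 0" unfolding E_same_row[OF t] by (rule dvd)
      then show ?thesis using road[OF i(1) True] F by simp
    next
      case False
      \<comment> \<open>A coordinate \<open>i\<close> above \<open>s\<close> is reflected to
        \<open>2 s - i\<close>, which is congruent to \<open>- k\<close>.\<close>
      have "2 * int (s_of t) dvd - (k - i) - 2 * int (s_of t)"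
        using dvd by (intro dvd_diff) (simp_all only: dvd_minus_iff dvd_refl)
      moreover have "- k - (2 * int (s_of t) - i) = - (k - i) - 2 * int (s_of t)" by simp
      ultimately have "2 * int (s_of t) dvd - k - (2 * int (s_of t) - i)" by (simp only:)
      then have "E t (- k) 0 = E t (2 * int (s_of t) - i) 0" unfolding E_same_row[OF t] .
      moreover have "F = face M (E t (- k) 0)" using face_E_neg[OF t, of k 0] F by simp
      ultimately show ?thesis using road[of "2 * int (s_of t) - i"] False i by simp
    qed
  qed
qed

section \<open>Existence and uniqueness of the parameters\<close>

lemma parametersI:
  assumes e: "bij_betw e {1..3} T" and "s_of (e 1) \<le> s_of (e 2)" "s_of (e 2) \<le> s_of (e 3)"
  shows "parameters M T e (\<lambda>i. s_of (e i)) (\<lambda>i. m_of (e i)) (\<lambda>i k. zigzag (e i) (int k))"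
proof -
  have "\<exists>PR. pseudo_road M PR \<and> hd PR = rev_dart (e i) \<and> s_of (e i) = length PR \<and>
      concentric_zigzags M (insert T (face M ` set PR)) (m_of (e i)) (\<lambda>k. zigzag (e i) (int k))"
    if "i \<in> {1..3}" for i
  proof -
    have t: "e i \<in> T" using bij_betwE[OF e] that by blast
    show ?thesis
    proof (intro exI[of _ "road (e i)"] conjI)
      show "pseudo_road M (road (e i))" by (rule pseudo_road_road[OF t])
      show "hd (road (e i)) = rev_dart (e i)" by (rule hd_road[OF t])
      show "s_of (e i) = length (road (e i))" by (simp add: road_def)
      show "concentric_zigzags M (insert T (face M ` set (road (e i)))) (m_of (e i)) (\<lambda>k. zigzag (e i) (int k))"
        unfolding road_patch[OF t] by (rule concentric_zigzags_row_faces[OF t])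
    qed
  qed
  then show ?thesis
    unfolding parameters_def using assms T by blast
qed

lemma ex_parameters: "\<exists>e s m Z. parameters M T e s m Z"
proof -
  obtain a b c where abc: "T = {a, b, c}" "a \<noteq> b" "a \<noteq> c" "b \<noteq> c" "s_of a \<le> s_of b" "s_of b \<le> s_of c"
    using ex_sorted_triple[OF card_T, of s_of] by blast
  define e where "e i = (if i = 1 then a else if i = 2 then b else c)" for i :: nat
  have "{1..3} = {1, 2, 3 :: nat}" by auto
  then have "bij_betw e {1..3} T"
    using abc(1-4) by (auto simp: bij_betw_def inj_on_def e_def)
  from parametersI[OF this] abc(5,6) show ?thesis
    by (intro exI) (simp add: e_def)
qed

text \<open>Once the labelling \<open>e\<close> is chosen, the numbers and zigzags in the relevant
  range are forced.\<close>

lemma parametersD: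
  assumes "parameters M T e s m Z"
  shows "bij_betw e {1..3} T" "\<And>i. i \<in> {1..3} \<Longrightarrow> s i = s_of (e i)" "\<And>i. i \<in> {1..3} \<Longrightarrow> m i = m_of (e i)"
    "\<And>i k. i \<in> {1..3} \<Longrightarrow> k \<in> {1..m i} \<Longrightarrow> Z i k = zigzag (e i) (int k)"
proof -
  show e: "bij_betw e {1..3} T" using assms unfolding parameters_def by blast
  fix i :: nat assume i: "i \<in> {1..3}"
  then have t: "e i \<in> T" using bij_betwE[OF e] by blast
  obtain PR where PR: "pseudo_road M PR" "hd PR = rev_dart (e i)" "s i = length PR"
    and conc: "concentric_zigzags M (insert T (face M ` set PR)) (m i) (Z i)"
    using assms i unfolding parameters_def by blast
  have road: "PR = road (e i)" by (rule pseudo_road_unique[OF t PR(1,2)])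
  then show "s i = s_of (e i)" using PR(3) by (simp add: road_def)
  have conc': "concentric_zigzags M (row_faces (e i) 0) (m i) (Z i)"
    using conc unfolding road road_patch[OF t] .
  show "m i = m_of (e i)" by (rule concentric_zigzags_row_faces_unique(1)[OF t conc'])
  show "Z i k = zigzag (e i) (int k)" if "k \<in> {1..m i}" for k
    by (rule concentric_zigzags_row_faces_unique(2)[OF t conc' that])
qed

section \<open>The z-vector and the intersection vectors\<close>

definition family :: "'a \<times> 'a \<Rightarrow> 'a zigzag set" where
  "family t = (\<lambda>k. zigzag t (int k)) ` {1..m_of t}"

lemma zigzags_eq_families: "zigzags M = (\<Union>t\<in>T. family t)"
  unfolding bij_betw_imp_surj_on[OF bij_betw_zigzag, symmetric] family_def by force

lemma familyE:
  assumes "z \<in> family t"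
  obtains k where "z = zigzag t (int k)"
  using assms by (auto simp: family_def)

lemma finite_family [simp]: "finite (family t)"
  by (simp add: family_def)

lemma card_family:
  assumes "t \<in> T"
  shows "card (family t) = m_of t"
proof -
  have "inj_on (\<lambda>k. zigzag t (int k)) {1..m_of t}"
  proof (rule inj_onI)
    fix k k' assume "k \<in> {1..m_of t}" "k' \<in> {1..m_of t}" "zigzag t (int k) = zigzag t (int k')"
    then show "k = k'"
      using inj_onD[OF bij_betw_imp_inj_on[OF bij_betw_zigzag], of "(t, k)" "(t, k')"] assms by simp
  qed
  then show ?thesis by (simp add: family_def card_image)
qed

lemma family_disjoint:
  assumes "t \<in> T" "t' \<in> T" "t \<noteq> t'"
  shows "family t \<inter> family t' = {}"
proof -
  have "zigzag t l \<noteq> zigzag t' l'" for l l'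
    using zigzag_eq_iff[OF assms(1,2)] assms(3) by simp
  then show ?thesis unfolding family_def by blast
qed

lemma card_zigzags: "card (zigzags M) = (\<Sum>t\<in>T. m_of t)"
  using bij_betw_same_card[OF bij_betw_zigzag] by simp

text \<open>The subset \<open>A\<close> makes this serve twice: with the whole family for the
  z-vector, with \<open>z\<close> removed for its intersection vector.\<close>

lemma image_mset_families:
  assumes "T = {a, b, c}" "a \<noteq> b" "a \<noteq> c" "b \<noteq> c"
    and "\<And>z. z \<in> A \<Longrightarrow> f z = x" "\<And>z. z \<in> family b \<Longrightarrow> f z = y" "\<And>z. z \<in> family c \<Longrightarrow> f z = w"
    and "A \<subseteq> family a"
  shows "image_mset f (mset_set (A \<union> (family b \<union> family c))) =
    replicate_mset (card A) x + replicate_mset (m_of b) y + replicate_mset (m_of c) w"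
proof -
  have T: "a \<in> T" "b \<in> T" "c \<in> T" using assms(1) by simp_all
  have "finite A" using assms(8) finite_subset finite_family by blast
  moreover have "A \<inter> (family b \<union> family c) = {}"
    using assms(8) family_disjoint[OF T(1,2) assms(2)] family_disjoint[OF T(1,3) assms(3)] by blast
  ultimately have "mset_set (A \<union> (family b \<union> family c)) = mset_set A + (mset_set (family b) + mset_set (family c))"
    using family_disjoint[OF T(2,3) assms(4)] by (simp add: mset_set_Union)
  then show ?thesis
    using image_mset_mset_set_const[of A f x] image_mset_mset_set_const[of "family b" f y]
      image_mset_mset_set_const[of "family c" f w] assms(5-7) card_family T by simp
qed

lemma z_vector_eq:
  assumes T3: "T = {a, b, c}" "a \<noteq> b" "a \<noteq> c" "b \<noteq> c"
  shows "z_vector M = replicate_mset (m_of a) (4 * s_of a, (0, 0)) +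
    replicate_mset (m_of b) (4 * s_of b, (0, 0)) + replicate_mset (m_of c) (4 * s_of c, (0, 0))"
proof -
  have T: "a \<in> T" "b \<in> T" "c \<in> T" using T3(1) by simp_all
  have val: "(zz_length z, signature z) = (4 * s_of t, (0, 0))" if t: "t \<in> T" and z: "z \<in> family t" for t z
  proof -
    obtain k where "z = zigzag t (int k)" using z by (rule familyE)
    then show ?thesis by (simp add: zz_length_zigzag[OF t] signature_zigzag[OF t])
  qed
  have "zigzags M = family a \<union> (family b \<union> family c)"
    unfolding zigzags_eq_families T3(1) by auto
  then show ?thesis
    unfolding z_vector_def
    using image_mset_families[OF T3 val[OF T(1)] val[OF T(2)] val[OF T(3)] order_refl]
    by (simp only: card_family[OF T(1)])
qed

lemma intersection_vector_eq:
  assumes T3: "T = {a, b, c}" "a \<noteq> b" "a \<noteq> c" "b \<noteq> c" and z: "z \<in> family a"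
  shows "intersection_vector M z = replicate_mset (m_of a - 1) 0 +
    replicate_mset (m_of b) (n div (2 * m_of a * m_of b)) +
    replicate_mset (m_of c) (n div (2 * m_of a * m_of c))"
proof -
  have T: "a \<in> T" "b \<in> T" "c \<in> T" using T3(1) by simp_all
  obtain l where l: "z = zigzag a l" using z by (rule familyE)
  have same: "card (zz_edges z \<inter> zz_edges z') = 0" if z': "z' \<in> family a - {z}" for z'
  proof -
    have "z' \<in> family a" "z \<noteq> z'" using z' by blast+
    moreover obtain k where "z' = zigzag a (int k)" using \<open>z' \<in> family a\<close> by (rule familyE)
    ultimately show ?thesis using zz_edges_disjoint[OF T(1), of l "int k"] l by simp
  qed
  have other: "card (zz_edges z \<inter> zz_edges z') = n div (2 * m_of a * m_of t)"
    if t: "t \<in> T" "a \<noteq> t" and z': "z' \<in> family t" for t z'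
  proof -
    obtain k where "z' = zigzag t (int k)" using z' by (rule familyE)
    then have "2 * m_of a * m_of t * card (zz_edges z \<inter> zz_edges z') = n"
      using card_zz_edges_Int[OF T(1) t] l by simp
    moreover have "2 * m_of a * m_of t > 0"
      using m_of(1)[OF T(1)] m_of(1)[OF t(1)] by simp
    ultimately show ?thesis
      using nonzero_mult_div_cancel_left[of "2 * m_of a * m_of t" "card (zz_edges z \<inter> zz_edges z')"] by simp
  qed
  have "zigzags M - {z} = (family a - {z}) \<union> (family b \<union> family c)"
    using z family_disjoint[OF T(1,2) T3(2)] family_disjoint[OF T(1,3) T3(3)]
    unfolding zigzags_eq_families T3(1) by auto
  moreover have "card (family a - {z}) = m_of a - 1"
    using z card_family[OF T(1)] by (simp add: card_Diff_singleton)
  ultimately show ?thesis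
    unfolding intersection_vector_def
    using image_mset_families[where f = "\<lambda>z'. card (zz_edges z \<inter> zz_edges z')" and A = "family a - {z}",
        OF T3 same other[OF T(2) T3(2)] other[OF T(3) T3(3)] Diff_subset]
    by simp
qed

text \<open>Equal lengths mean equal \<open>s\<close>, hence equal \<open>m\<close> by
  \<open>n = 4 s m\<close>. The intersection vector depends only on the three values of
  \<open>m\<close>, so exchanging two classes with the same \<open>m\<close> does not change
  it.\<close>

lemma z_balanced: "z_balanced M"
  unfolding z_balanced_def
proof (intro ballI impI)
  fix z z' assume z: "z \<in> zigzags M" "z' \<in> zigzags M"
    and "zz_length z = zz_length z' \<and> signature z = signature z'"
  then have len: "zz_length z = zz_length z'" by simp
  obtain t t' where t: "t \<in> T" "z \<in> family t" "t' \<in> T" "z' \<in> family t'"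
    using z unfolding zigzags_eq_families by blast
  have "zz_length z = 4 * s_of t" "zz_length z' = 4 * s_of t'"
    using zz_length_zigzag[OF t(1)] zz_length_zigzag[OF t(3)] familyE[OF t(2)] familyE[OF t(4)] by metis+
  then have s: "s_of t = s_of t'" using len by simp
  have "4 * s_of t * m_of t = 4 * s_of t' * m_of t'"
    by (rule trans[OF n_eq[OF t(1), symmetric] n_eq[OF t(3)]])
  then have m: "m_of t = m_of t'" using s s_of(1)[OF t(3)] by simp
  show "intersection_vector M z = intersection_vector M z'"
  proof (cases "t = t'")
    case True
    have T3: "T = {t, L t, L (L t)}" "t \<noteq> L t" "t \<noteq> L (L t)" "L t \<noteq> L (L t)"
      using T_eq[OF t(1)] T_distinct[OF t(1)] by auto
    show ?thesis
      using intersection_vector_eq[OF T3 t(2)] intersection_vector_eq[OF T3, of z'] t(4) True by simp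
  next
    case False
    have "card (T - {t, t'}) = 1" using card_T t(1,3) False by (simp add: card_Diff_subset)
    then obtain u where "T - {t, t'} = {u}" by (auto simp: card_1_singleton_iff)
    then have T3: "T = {t, t', u}" "t \<noteq> u" "t' \<noteq> u" using t(1,3) by auto
    then have T3': "T = {t', t, u}" by auto
    show ?thesis
      using intersection_vector_eq[OF T3(1) False T3(2,3) t(2)]
        intersection_vector_eq[OF T3' False[symmetric] T3(3,2) t(4)] m by simp
  qed
qed

text \<open>Darts of one class have distinct tails. If a dart \<open>L y\<close> and a dart
  \<open>L (L z)\<close> of the zigzag left the same vertex, the cyclic order of classes there would
  make the second the rotation of the first.\<close>

lemma inj_on_tail_zz_darts:
  assumes t: "t \<in> T"
  shows "inj_on fst (zz_darts t l)"
proof (rule inj_onI)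
  have t': "L t \<in> T" "L (L t) \<in> T" using t by simp_all
  have row: "L y \<in> dart_class (L t)" "L (L y) \<in> dart_class (L (L t))" if y: "y \<in> row t l" for y
  proof -
    have "y \<in> dart_class t" using row_subset_class y by blast
    then show "L y \<in> dart_class (L t)" by (simp only: L_in_class[OF t])
    then show "L (L y) \<in> dart_class (L (L t))" by (simp only: L_in_class[OF t'(1)])
  qed
  have D: "L y \<in> D" "L (L y) \<in> D" if y: "y \<in> row t l" for y
    using row_subset_D[OF t, of l] y by auto
  have mixed: "fst (L y) \<noteq> fst (L (L z))" if y: "y \<in> row t l" and z: "z \<in> row t l" for y z
  proof
    assume "fst (L y) = fst (L (L z))"
    then have "L (L z) \<in> {L y, rot M (L y), rot M (rot M (L y))}"
      using same_tail[OF D(1)[OF y] D(2)[OF z]] by simp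
    moreover have "L y \<noteq> L (L z)" by (rule L_row_disjoint_L_L_row[OF t y z])
    moreover have "rot M (L y) \<in> dart_class (L (L t))"
      using rot_in_class[OF t'(1) row(1)[OF y]] .
    then have "rot M (rot M (L y)) \<in> dart_class t"
      using rot_in_class[OF t'(2)] LLL_T[OF t] by simp
    then have "rot M (rot M (L y)) \<noteq> L (L z)"
      using class_neq[OF t t'(2) _ _ row(2)[OF z]] T_distinct(2)[OF t] by metis
    ultimately have "L (L z) = rot M (L y)" by auto
    \<comment> \<open>So the zigzag would meet its own reversal.\<close>
    then have "L z = rev_dart (L y)" by (simp add: rot_eq)
    then have "z \<in> row t (1 - l)" using rev_L_row[OF t y] by auto
    moreover have "L z \<in> zz_darts t l" using z unfolding zz_darts_def by blast
    ultimately show False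
      using zz_darts_rev_disjoint[OF t, of l] unfolding zz_darts_def by blast
  qed
  fix a b assume ab: "a \<in> zz_darts t l" "b \<in> zz_darts t l" "fst a = fst b"
  obtain y where y: "y \<in> row t l" "a = L y \<or> a = L (L y)"
    using ab(1) unfolding zz_darts_def by blast
  obtain z where z: "z \<in> row t l" "b = L z \<or> b = L (L z)"
    using ab(2) unfolding zz_darts_def by blast
  note inj = inj_onD[OF bij_betw_imp_inj_on[OF bij_betw_class_vertices]]
  from y(2) z(2) mixed[OF y(1) z(1)] mixed[OF z(1) y(1)] ab(3)
  consider "a = L y" "b = L z" | "a = L (L y)" "b = L (L z)" by metis
  then show "a = b"
  proof cases
    case 1
    then show ?thesis using inj[OF t'(1) ab(3)] row(1)[OF y(1)] row(1)[OF z(1)] by simp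
  next
    case 2
    then show ?thesis using inj[OF t'(2) ab(3)] row(2)[OF y(1)] row(2)[OF z(1)] by simp
  qed
qed

text \<open>For \<open>m = 1\<close> the length \<open>4 s\<close> equals \<open>n\<close>, so
  distinct tails exhaust the vertices.\<close>

lemma hamiltonian_zigzag_zigzag:
  assumes t: "t \<in> T" and m: "m_of t = 1"
  shows "hamiltonian_zigzag M (zigzag t l)"
proof -
  have "bij_betw (fst \<circ> fst) (zz t l) (vertices M)" for l
  proof -
    have inj: "inj_on (fst \<circ> fst) (zz t l)"
      using inj_on_fst_zz[OF t] inj_on_tail_zz_darts[OF t] by (intro comp_inj_on) (simp_all add: fst_zz)
    have "(fst \<circ> fst) ` zz t l \<subseteq> vertices M"
      using zz_darts_subset_D[OF t, of l] arc_fst_in_verts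
      unfolding image_comp[symmetric] fst_zz by blast
    moreover have "card ((fst \<circ> fst) ` zz t l) = card (vertices M)"
      using card_image[OF inj] card_zz[OF t] n_eq[OF t] m card_vertices by simp
    ultimately have "(fst \<circ> fst) ` zz t l = vertices M"
      using pair_finite_verts by (intro card_subset_eq) simp_all
    with inj show ?thesis by (rule bij_betw_imageI)
  qed
  then show ?thesis by (simp add: hamiltonian_zigzag_def zigzag_def)
qed

section \<open>Tightness and the numbers of zigzags and railroads\<close>

lemma tight_iff: "tight M \<longleftrightarrow> (\<forall>t\<in>T. m_of t = 1)"
proof -
  have "tight M \<longleftrightarrow> card (railroads M) = 0"
    using finite_railroads by (simp add: tight_def)
  also have "\<dots> \<longleftrightarrow> (\<forall>t\<in>T. m_of t - 1 = 0)"
    unfolding card_railroads by (rule sum_eq_0_iff[OF finite_T])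
  also have "\<dots> \<longleftrightarrow> (\<forall>t\<in>T. m_of t = 1)"
  proof (rule ball_cong[OF refl])
    fix t assume "t \<in> T"
    then show "m_of t - 1 = 0 \<longleftrightarrow> m_of t = 1" using m_of(1)[of t] by linarith
  qed
  finally show ?thesis .
qed

lemma card_zigzags_ge_3: "3 \<le> card (zigzags M)"
proof -
  have "(\<Sum>t\<in>T. 1) \<le> (\<Sum>t\<in>T. m_of t)"
    using m_of(1) by (intro sum_mono) (simp add: Suc_le_eq)
  then show ?thesis by (simp add: card_zigzags card_T)
qed

text \<open>In integers, to avoid truncated subtraction.\<close>

lemma int_card_railroads: "int (card (railroads M)) = (\<Sum>t\<in>T. int (m_of t)) - 3"
proof -
  have "int (card (railroads M)) = (\<Sum>t\<in>T. int (m_of t) - 1)"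
    unfolding card_railroads of_nat_sum
    using m_of(1) by (intro sum.cong) (simp_all add: of_nat_diff Suc_le_eq)
  then show ?thesis by (simp add: sum_subtractf card_T)
qed

lemma card_zigzags_eq_3_iff: "card (zigzags M) = 3 \<longleftrightarrow> tight M"
proof -
  have "int (card (zigzags M)) = int (card (railroads M)) + 3"
    unfolding int_card_railroads card_zigzags by simp
  then have "card (zigzags M) = 3 \<longleftrightarrow> card (railroads M) = 0" by linarith
  then show ?thesis using finite_railroads by (simp add: tight_def)
qed

lemma parameters_zigzags:
  assumes "parameters M T e s m Z"
  shows "z_vector M =
      replicate_mset (m 1) (4 * s 1, (0, 0)) +
      replicate_mset (m 2) (4 * s 2, (0, 0)) +
      replicate_mset (m 3) (4 * s 3, (0, 0))"
    and "bij_betw (\<lambda>(i, k). Z i k) (SIGMA i:{1..3}. {1..m i}) (zigzags M)"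
    and "\<forall>i\<in>{1..3}. \<forall>k\<in>{1..m i}. zz_length (Z i k) = 4 * s i"
    and "int (card (railroads M)) = int (m 1) + int (m 2) + int (m 3) - 3"
proof -
  note e = parametersD(1)[OF assms] and s = parametersD(2)[OF assms]
    and m = parametersD(3)[OF assms] and Z = parametersD(4)[OF assms]
  have in_T: "e i \<in> T" if "i \<in> {1..3}" for i using bij_betwE[OF e] that by blast
  have set3: "{1..3} = {1, 2, 3 :: nat}" by auto
  have T3: "T = {e 1, e 2, e 3}" using bij_betw_imp_surj_on[OF e] unfolding set3 by auto
  have dist: "e 1 \<noteq> e 2" "e 1 \<noteq> e 3" "e 2 \<noteq> e 3"
    using bij_betw_imp_inj_on[OF e] unfolding inj_on_def by force+
  show "z_vector M = replicate_mset (m 1) (4 * s 1, (0, 0)) +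
      replicate_mset (m 2) (4 * s 2, (0, 0)) + replicate_mset (m 3) (4 * s 3, (0, 0))"
    using z_vector_eq[OF T3 dist] s m by simp
  \<comment> \<open>Reindexing from the darts of \<open>T\<close> to the labels 1, 2, 3.\<close>
  have Sigma: "bij_betw (map_prod e id) (SIGMA i:{1..3}. {1..m i}) (SIGMA t:T. {1..m_of t})"
  proof (rule bij_betw_imageI)
    show "inj_on (map_prod e id) (SIGMA i:{1..3}. {1..m i})"
      using bij_betw_imp_inj_on[OF e] by (auto simp: inj_on_def)
    show "map_prod e id ` (SIGMA i:{1..3}. {1..m i}) = (SIGMA t:T. {1..m_of t})"
    proof (intro equalityI subsetI)
      fix x assume "x \<in> (SIGMA t:T. {1..m_of t})"
      then obtain t k where x: "x = (t, k)" "t \<in> T" "k \<in> {1..m_of t}" by (rule SigmaE)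
      obtain i where "i \<in> {1..3}" "t = e i" using x(2) bij_betw_imp_surj_on[OF e] by blast
      then show "x \<in> map_prod e id ` (SIGMA i:{1..3}. {1..m i})"
        using x m by (intro image_eqI[of _ _ "(i, k)"]) simp_all
    next
      fix x assume "x \<in> map_prod e id ` (SIGMA i:{1..3}. {1..m i})"
      then obtain i k where "i \<in> {1..3}" "k \<in> {1..m i}" "x = (e i, k)" by auto
      then show "x \<in> (SIGMA t:T. {1..m_of t})" using in_T m by simp
    qed
  qed
  have "bij_betw ((\<lambda>(t, k). zigzag t (int k)) \<circ> map_prod e id) (SIGMA i:{1..3}. {1..m i}) (zigzags M)"
    using Sigma bij_betw_zigzag by (rule bij_betw_trans)
  then show "bij_betw (\<lambda>(i, k). Z i k) (SIGMA i:{1..3}. {1..m i}) (zigzags M)"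
  proof (subst bij_betw_cong)
    fix x assume "x \<in> (SIGMA i:{1..3}. {1..m i})"
    then obtain i k where "x = (i, k)" "i \<in> {1..3}" "k \<in> {1..m i}" by (rule SigmaE)
    then show "(\<lambda>(i, k). Z i k) x = ((\<lambda>(t, k). zigzag t (int k)) \<circ> map_prod e id) x"
      using Z by simp
  qed
  show "\<forall>i\<in>{1..3}. \<forall>k\<in>{1..m i}. zz_length (Z i k) = 4 * s i"
    using Z s in_T zz_length_zigzag by simp
  show "int (card (railroads M)) = int (m 1) + int (m 2) + int (m 3) - 3"
    unfolding int_card_railroads T3 using dist m by simp
qed

lemma parameters_intersection:
  assumes "parameters M T e s m Z"
    and i: "i \<in> {1..3}" "k \<in> {1..m i}" and j: "j \<in> {1..3}" "l \<in> {1..m j}" and neq: "Z i k \<noteq> Z j l"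
  shows "real (card (zz_edges (Z i k) \<inter> zz_edges (Z j l))) =
    (if i = j then 0 else real n / (2 * real (m i) * real (m j)))"
proof -
  note e = parametersD(1)[OF assms(1)] and m = parametersD(3)[OF assms(1)] and Z = parametersD(4)[OF assms(1)]
  have T: "e i \<in> T" "e j \<in> T" using bij_betwE[OF e] i j by blast+
  show ?thesis
  proof (cases "i = j")
    case True
    then show ?thesis
      using zz_edges_disjoint[OF T(1), of "int k" "int l"] neq Z[OF i] Z[OF j] by simp
  next
    case False
    then have "e i \<noteq> e j" using bij_betw_imp_inj_on[OF e] i(1) j(1) by (auto dest: inj_onD)
    then have "2 * m i * m j * card (zz_edges (Z i k) \<inter> zz_edges (Z j l)) = n"
      using card_zz_edges_Int[OF T] m i(1) j(1) Z[OF i] Z[OF j] by simp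
    then have "2 * real (m i) * real (m j) * real (card (zz_edges (Z i k) \<inter> zz_edges (Z j l))) = real n"
      by (metis of_nat_mult of_nat_numeral)
    moreover have "real (m i) > 0" "real (m j) > 0" using i(2) j(2) by simp_all
    ultimately show ?thesis using False by (simp add: field_simps)
  qed
qed

lemma simple_zigzags: "z \<in> zigzags M \<Longrightarrow> simple_zigzag z"
  using zigzags_eq simple_zigzag_zigzag by auto

lemma tight_zigzags:
  assumes "tight M"
  shows "z_vector M = replicate_mset 3 (n, (0, 0))"
    and "\<And>z. z \<in> zigzags M \<Longrightarrow> simple_zigzag z \<and> zz_length z = n \<and> hamiltonian_zigzag M z"
proof -
  have m: "m_of t = 1" if "t \<in> T" for t using assms that tight_iff by blast
  have s: "4 * s_of t = n" if "t \<in> T" for t using n_eq[OF that] m[OF that] by simp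
  obtain t where t: "t \<in> T" using ex_T by blast
  have T3: "T = {t, L t, L (L t)}" "t \<noteq> L t" "t \<noteq> L (L t)" "L t \<noteq> L (L t)"
    using T_eq[OF t] T_distinct[OF t] by auto
  show "z_vector M = replicate_mset 3 (n, (0, 0))"
    unfolding z_vector_eq[OF T3] using t by (simp add: m s numeral_3_eq_3)
  fix z assume "z \<in> zigzags M"
  then obtain t l where "t \<in> T" "z = zigzag t l" using zigzags_eq by auto
  then show "simple_zigzag z \<and> zz_length z = n \<and> hamiltonian_zigzag M z"
    using simple_zigzag_zigzag zz_length_zigzag s hamiltonian_zigzag_zigzag m by simp
qed

end

theorem theorem5p4:
  fixes M :: "'v plane_map" and n :: nat
  assumes "type_3 n M"
  shows
    "\<comment> \<open>the parameters exist, whatever triangle is fixed\<close>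
     (triangles M \<noteq> {} \<and> (\<forall>T\<in>triangles M. \<exists>e s m Z. parameters M T e s m Z)) \<and>
     \<comment> \<open>(i)\<close>
     (\<forall>T e s m Z. parameters M T e s m Z \<longrightarrow>
        z_vector M =
          replicate_mset (m 1) (4 * s 1, (0, 0)) +
          replicate_mset (m 2) (4 * s 2, (0, 0)) +
          replicate_mset (m 3) (4 * s 3, (0, 0)) \<and>
        (\<forall>z\<in>zigzags M. simple_zigzag z) \<and>
        bij_betw (\<lambda>(i, k). Z i k) (SIGMA i:{1..3}. {1..m i}) (zigzags M) \<and>
        (\<forall>i\<in>{1..3}. \<forall>k\<in>{1..m i}. zz_length (Z i k) = 4 * s i) \<and>
        int (card (railroads M)) = int (m 1) + int (m 2) + int (m 3) - 3) \<and>
     \<comment> \<open>(ii)\<close>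
     (3 \<le> card (zigzags M) \<and> (card (zigzags M) = 3 \<longleftrightarrow> tight M)) \<and>
     \<comment> \<open>(iii)\<close>
     (tight M \<longrightarrow>
        z_vector M = replicate_mset 3 (n, (0, 0)) \<and>
        (\<forall>z\<in>zigzags M. simple_zigzag z \<and> zz_length z = n \<and> hamiltonian_zigzag M z)) \<and>
     \<comment> \<open>(iv)\<close>
     (z_balanced M \<and>
      (\<forall>T e s m Z. parameters M T e s m Z \<longrightarrow>
         (\<forall>i\<in>{1..3}. \<forall>j\<in>{1..3}. \<forall>k\<in>{1..m i}. \<forall>l\<in>{1..m j}.
            Z i k \<noteq> Z j l \<longrightarrow>
            real (card (zz_edges (Z i k) \<inter> zz_edges (Z j l))) =
              (if i = j then 0 else real n / (2 * real (m i) * real (m j))))))"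
proof -
  interpret type_3_map M n by unfold_locales (rule assms)
  have triangle_map: "triangle_map M n T" if "T \<in> triangles M" for T
    using that by unfold_locales
  obtain T0 where T0: "T0 \<in> triangles M" using triangles_nonempty by blast
  \<comment> \<open>Claims that do not mention parameters are proved from an arbitrary triangle; the
    others from the triangle on which the parameters are based.\<close>
  interpret T0: triangle_map M n T0 by (rule triangle_map[OF T0])
  have param: "triangle_map M n T" if "parameters M T e s m Z" for T e s m Z
    using that by (intro triangle_map) (simp add: parameters_def)
  have "\<exists>e s m Z. parameters M T e s m Z" if "T \<in> triangles M" for T
    using triangle_map.ex_parameters[OF triangle_map[OF that]] .
  moreover have "z_vector M =
        replicate_mset (m 1) (4 * s 1, (0, 0)) +
        replicate_mset (m 2) (4 * s 2, (0, 0)) +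
        replicate_mset (m 3) (4 * s 3, (0, 0)) \<and>
      (\<forall>z\<in>zigzags M. simple_zigzag z) \<and>
      bij_betw (\<lambda>(i, k). Z i k) (SIGMA i:{1..3}. {1..m i}) (zigzags M) \<and>
      (\<forall>i\<in>{1..3}. \<forall>k\<in>{1..m i}. zz_length (Z i k) = 4 * s i) \<and>
      int (card (railroads M)) = int (m 1) + int (m 2) + int (m 3) - 3"
    if "parameters M T e s m Z" for T e s m Z
    by (intro conjI ballI T0.simple_zigzags triangle_map.parameters_zigzags[OF param[OF that] that]
        triangle_map.parameters_zigzags(3)[OF param[OF that] that, THEN bspec, THEN bspec])
  moreover have "real (card (zz_edges (Z i k) \<inter> zz_edges (Z j l))) =
      (if i = j then 0 else real n / (2 * real (m i) * real (m j)))"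
    if "parameters M T e s m Z" "i \<in> {1..3}" "j \<in> {1..3}" "k \<in> {1..m i}" "l \<in> {1..m j}" "Z i k \<noteq> Z j l"
    for T e s m Z i j k l
    using triangle_map.parameters_intersection[OF param[OF that(1)] that(1,2,4,3,5,6)] .
  ultimately show ?thesis
    using T0 T0.card_zigzags_ge_3 T0.card_zigzags_eq_3_iff T0.tight_zigzags T0.z_balanced
    by (intro conjI allI impI ballI) blast+
qed

end
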